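(* Let $(X,\mu)$ be a nonatomic probability space equipped with a tree $\mathcal{T}$. Let $1<q<p$ and $r>0$, and write $p'=\frac{p}{p-1}$, $q'=\frac{q}{q-1}$. For real $F,f,L$ with $0<f<p'F^{1/p}$ and $f\le L$ define $$\mathcal{B}(F,f,L)=\sup\left\{\left\|\max(M_{\mathcal{T}}\phi,L)\right\|_{L^{q,r}(X,\mu)}^{r}:\ \phi\ge0\text{ measurable on }X,\ \|\phi\|_{L^1(X,\mu)}=f,\ \|\phi\|_{L^{p,\infty}(X,\mu)}^{p}=F\right\}.$$ Then $$\mathcal{B}(F,f,L)=\frac{q(p-1)q'}{r(p-q)}(p')^{\frac{p'r}{q'}}f^{\frac{r(p-q)}{q(p-1)}}F^{\frac{r(q-1)}{q(p-1)}}+\frac qr L^r-\frac qr q' f^{\frac rq}L^{\frac rq(q-1)}\quad\text{when } L\le (p')^{p'}\left(\frac Ff\right)^{\frac1{p-1}},$$ and $$\mathcal{B}(F,f,L)=\frac{q\,(p')^{rp/q}}{r\left(\frac pq-1\right)}F^{\frac rq}L^{r\left(1-\frac pq\right)}+\frac qr L^r\quad\text{when } L\ge (p')^{p'}\left(\frac Ff\right)^{\frac1{p-1}}.$$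
   Context: Let $(X,\mu)$ be a nonatomic probability space. Two measurable sets $A,B\subseteq X$ are almost disjoint if $\mu(A\cap B)=0$. A set $\mathcal{T}$ of measurable subsets of $X$ is called a tree if: (i) $X\in\mathcal{T}$ and $\mu(I)>0$ for every $I\in\mathcal{T}$; (ii) for every $I\in\mathcal{T}$ there corresponds a finite subset $\mathcal{C}(I)\subseteq\mathcal{T}$ with at least two elements, whose elements are pairwise almost disjoint subsets of $I$ and such that $I=\bigcup\mathcal{C}(I)$; (iii) $\mathcal{T}=\bigcup_{m\ge0}\mathcal{T}_{(m)}$, where $\mathcal{T}_{(0)}=\{X\}$ and $\mathcal{T}_{(m+1)}=\bigcup_{I\in\mathcal{T}_{(m)}}\mathcal{C}(I)$; (iv) $\lim_{m\to\infty}\sup_{I\in\mathcal{T}_{(m)}}\mu(I)=0$. The associated maximal operator is $M_{\mathcal{T}}\phi(x)=\sup\{\frac1{\mu(I)}\int_I|\phi|\,d\mu: x\in I\in\mathcal{T}\}$ for $\phi\in L^1(X,\mu)$. For measurable $\psi$ on $X$, $\psi^*:(0,1]\to[0,+\infty]$ denotes the equimeasurable non-increasing (right-continuous) rearrangement of $|\psi|$. The Lorentz quasinorms are normalized by $\|\psi\|_{L^{q,r}(X,\mu)}^r=\int_0^1 t^{\frac rq-1}\psi^*(t)^r\,dt$ and $\|\psi\|_{L^{p,\infty}(X,\mu)}=\sup_{0<t\le1}t^{1/p}\psi^*(t)$. Here $\max(M_{\mathcal{T}}\phi,L)$ is the pointwise maximum of the function $M_{\mathcal{T}}\phi$ and the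 constant $L$. *)

theory Defs
  imports "HOL-Probability.Probability"
begin

definition nonatomic :: "'a measure \<Rightarrow> bool" where
  "nonatomic M \<longleftrightarrow>
    (\<forall>A\<in>sets M. 0 < emeasure M A \<longrightarrow>
      (\<exists>B\<in>sets M. B \<subseteq> A \<and> 0 < emeasure M B \<and> emeasure M B < emeasure M A))"

definition almost_disjoint :: "'a measure \<Rightarrow> 'a set \<Rightarrow> 'a set \<Rightarrow> bool" where
  "almost_disjoint M A B \<longleftrightarrow> emeasure M (A \<inter> B) = 0"

primrec tree_level :: "'a set \<Rightarrow> ('a set \<Rightarrow> 'a set set) \<Rightarrow> nat \<Rightarrow> 'a set set" where
  "tree_level X C 0 = {X}"
| "tree_level X C (Suc m) = (\<Union>I\<in>tree_level X C m. C I)"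

definition is_tree :: "'a measure \<Rightarrow> 'a set set \<Rightarrow> bool" where
  "is_tree M T \<longleftrightarrow>
    T \<subseteq> sets M \<and> space M \<in> T \<and> (\<forall>I\<in>T. 0 < emeasure M I) \<and>
    (\<exists>C. (\<forall>I\<in>T. C I \<subseteq> T \<and> finite (C I) \<and> 2 \<le> card (C I) \<and>
                  pairwise (almost_disjoint M) (C I) \<and>
                  (\<forall>J\<in>C I. J \<subseteq> I) \<and> I = \<Union>(C I)) \<and>
         T = (\<Union>m. tree_level (space M) C m) \<and>
         (\<lambda>m. SUP I\<in>tree_level (space M) C m. emeasure M I) \<longlonglongrightarrow> 0)"

(* The supremum may be infinite at individual points, hence the value type ennreal. *)
definition maximal_op :: "'a measure \<Rightarrow> 'a set set \<Rightarrow> ('a \<Rightarrow> real) \<Rightarrow> 'a \<Rightarrow> ennreal" where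
  "maximal_op M T \<phi> x =
    (SUP I\<in>{I\<in>T. x \<in> I}. (\<integral>\<^sup>+y\<in>I. ennreal \<bar>\<phi> y\<bar> \<partial>M) / emeasure M I)"

(* Intended for exponents a > 0 only. *)
definition ennreal_powr :: "ennreal \<Rightarrow> real \<Rightarrow> ennreal" where
  "ennreal_powr x a = (if x = \<infinity> then \<infinity> else ennreal (enn2real x powr a))"

(* The right-continuous version; the argument psi plays the role of the modulus of a function.
   On a probability space the value at t = 1 is 0, which affects neither quasinorm below. *)
definition rearrangement :: "'a measure \<Rightarrow> ('a \<Rightarrow> ennreal) \<Rightarrow> real \<Rightarrow> ennreal" where
  "rearrangement M \<psi> t = Inf {s. emeasure M {x\<in>space M. s < \<psi> x} \<le> ennreal t}"

definition lorentz_norm :: "'a measure \<Rightarrow> real \<Rightarrow> real \<Rightarrow> ('a \<Rightarrow> ennreal) \<Rightarrow> ennreal" where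
  "lorentz_norm M q r \<psi> =
    ennreal_powr
      (\<integral>\<^sup>+t\<in>{0<..1}. ennreal (t powr (r / q - 1)) * ennreal_powr (rearrangement M \<psi> t) r \<partial>lborel)
      (1 / r)"

definition weak_lorentz_norm :: "'a measure \<Rightarrow> real \<Rightarrow> ('a \<Rightarrow> ennreal) \<Rightarrow> ennreal" where
  "weak_lorentz_norm M p \<psi> =
    (SUP t\<in>{0<..1}. ennreal (t powr (1 / p)) * rearrangement M \<psi> t)"

definition bellman_admissible :: "'a measure \<Rightarrow> real \<Rightarrow> real \<Rightarrow> real \<Rightarrow> ('a \<Rightarrow> real) set" where
  "bellman_admissible M p F f =
    {\<phi>. \<phi> \<in> borel_measurable M \<and> (\<forall>x\<in>space M. 0 \<le> \<phi> x) \<and>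
        integrable M \<phi> \<and> (\<integral>x. \<bar>\<phi> x\<bar> \<partial>M) = f \<and>
        ennreal_powr (weak_lorentz_norm M p (\<lambda>x. ennreal \<bar>\<phi> x\<bar>)) p = ennreal F}"

definition bellman ::
  "'a measure \<Rightarrow> 'a set set \<Rightarrow> real \<Rightarrow> real \<Rightarrow> real \<Rightarrow> real \<Rightarrow> real \<Rightarrow> real \<Rightarrow> ennreal" where
  "bellman M T p q r F f L =
    (SUP \<phi>\<in>bellman_admissible M p F f.
      ennreal_powr (lorentz_norm M q r (\<lambda>x. max (maximal_op M T \<phi> x) (ennreal L))) r)"

end

theory Submission
  imports Defs
begin

text \<open>
  Put \<open>H t = min (f / t) (p' F^(1/p) t^(-1/p))\<close>; both cases of the
  formula are \<open>\<integral> t^(r/q-1) (max (H t) L)^r\<close> over \<open>(0, 1]\<close>.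

  Upper bound: on \<open>E = {M\<phi> > s}\<close> the weak type inequality \<open>s \<mu>(E) \<le> \<integral>\<^sub>E \<phi>\<close> holds, and the
  right-hand side is at most \<open>f\<close> and, by the weak norm, at most \<open>p' F^(1/p) \<mu>(E)^(1-1/p)\<close>.
  Hence the rearrangement of \<open>max (M\<phi>) L\<close> lies below \<open>max H L\<close>.

  Lower bound: for \<open>\<beta> < 1\<close> choose nested sets \<open>E\<^sub>0 \<supseteq> E\<^sub>1 \<supseteq> \<dots>\<close> of measure \<open>\<beta>\<^sup>k\<close>, each a union
  of almost disjoint tree elements that it shares out proportionally: \<open>\<mu>(J \<inter> E\<^sub>k\<^sub>+\<^sub>i) = \<beta>\<^sup>i \<mu>(J)\<close>
  for the elements \<open>J\<close> that make up \<open>E\<^sub>k\<close>. A function that is constant on every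
  \<open>E\<^sub>k - E\<^sub>k\<^sub>+\<^sub>1\<close> then has the same average on all these \<open>J\<close>, so \<open>M\<phi>\<close> is bounded below on \<open>E\<^sub>k\<close>
  by its average over \<open>E\<^sub>k\<close>. Discretizing \<open>F^(1/p) t^(-1/p)\<close> truncated to mass \<open>f\<close> in this way
  gives an exactly admissible \<open>\<phi>\<close>, and \<open>H\<close> is approached as \<open>\<beta> \<rightarrow> 1\<close>.
\<close>

section \<open>Subfamilies of a tree with prescribed measure\<close>

text \<open>Tree elements are only almost disjoint. Their pairwise overlaps form a countable union
  \<open>N\<close> of null sets, and without \<open>N\<close> the family is disjoint, so countable
  additivity applies.\<close>

lemma emeasure_UN_null_overlap:
  assumes S: "countable S" and A: "\<And>i. i \<in> S \<Longrightarrow> A i \<in> sets M"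
    and null: "\<And>i j. i \<in> S \<Longrightarrow> j \<in> S \<Longrightarrow> i \<noteq> j \<Longrightarrow> emeasure M (A i \<inter> A j) = 0"
  shows "emeasure M (\<Union>i\<in>S. A i) = (\<integral>\<^sup>+i. emeasure M (A i) \<partial>count_space S)"
proof -
  define N where "N = (\<Union>i\<in>S. \<Union>j\<in>S-{i}. A i \<inter> A j)"
  have N: "N \<in> null_sets M"
    unfolding N_def using S A null by (intro null_sets_UN') (auto intro!: null_setsI)
  have "emeasure M (\<Union>i\<in>S. A i) = emeasure M ((\<Union>i\<in>S. A i) - N)"
    using N S A by (intro emeasure_Diff_null_set[symmetric]) auto
  also have "(\<Union>i\<in>S. A i) - N = (\<Union>i\<in>S. A i - N)" by auto
  also have "emeasure M \<dots> = (\<integral>\<^sup>+i. emeasure M (A i - N) \<partial>count_space S)"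
    using S A N by (intro emeasure_UN_countable) (auto simp: disjoint_family_on_def N_def)
  also have "\<dots> = (\<integral>\<^sup>+i. emeasure M (A i) \<partial>count_space S)"
    using A N by (intro nn_integral_cong) (simp add: emeasure_Diff_null_set)
  finally show ?thesis .
qed

lemma emeasure_UN_finite_null_overlap:
  assumes S: "finite S" and A: "\<And>i. i \<in> S \<Longrightarrow> A i \<in> sets M"
    and null: "\<And>i j. i \<in> S \<Longrightarrow> j \<in> S \<Longrightarrow> i \<noteq> j \<Longrightarrow> emeasure M (A i \<inter> A j) = 0"
  shows "emeasure M (\<Union>i\<in>S. A i) = (\<Sum>i\<in>S. emeasure M (A i))"
  using emeasure_UN_null_overlap[of S A M] assms
  by (simp add: countable_finite nn_integral_count_space_finite)

text \<open>Adding elements one at a time, \<open>x\<close> is one at which the partial sums pass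
  \<rho>; \<open>D\<close> collects what was added before it.\<close>

lemma greedy_subset_sum:
  fixes w :: "'b \<Rightarrow> real"
  assumes "finite S" "S \<noteq> {}" "0 \<le> \<rho>" "\<rho> \<le> sum w S"
  shows "\<exists>D x. D \<subseteq> S \<and> x \<in> S - D \<and> sum w D \<le> \<rho> \<and> \<rho> \<le> sum w D + w x"
  using assms
proof (induction S rule: finite_ne_induct)
  case (singleton x)
  then show ?case by (intro exI[of _ "{}"] exI[of _ x]) auto
next
  case (insert x S)
  show ?case
  proof (cases "\<rho> \<le> sum w S")
    case True
    then show ?thesis using insert by (metis Diff_iff insertCI subset_insertI2)
  next
    case False
    then show ?thesis using insert
      by (intro exI[of _ S] exI[of _ x]) auto
  qed
qed

text \<open>The child map hidden by the existential quantifier in \<open>is_tree\<close> is fixed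
  once, so that every construction below descends along the same children.\<close>

locale tree_space = prob_space M for M :: "'a measure" +
  fixes T :: "'a set set" and C :: "'a set \<Rightarrow> 'a set set"
  assumes T_sets: "T \<subseteq> sets M"
    and space_T: "space M \<in> T"
    and T_pos: "I \<in> T \<Longrightarrow> 0 < emeasure M I"
    and C_T: "I \<in> T \<Longrightarrow> C I \<subseteq> T"
    and C_finite: "I \<in> T \<Longrightarrow> finite (C I)"
    and C_card: "I \<in> T \<Longrightarrow> 2 \<le> card (C I)"
    and C_disj: "I \<in> T \<Longrightarrow> pairwise (almost_disjoint M) (C I)"
    and C_sub: "I \<in> T \<Longrightarrow> J \<in> C I \<Longrightarrow> J \<subseteq> I"
    and C_Union: "I \<in> T \<Longrightarrow> I = \<Union>(C I)"
    and T_levels: "T = (\<Union>m. tree_level (space M) C m)"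
    and level_lim: "(\<lambda>m. SUP I\<in>tree_level (space M) C m. emeasure M I) \<longlonglongrightarrow> 0"

lemma is_tree_obtain:
  assumes "prob_space M" "is_tree M T"
  obtains C where "tree_space M T C"
proof -
  from assms(2)[unfolded is_tree_def] obtain C where
    T: "T \<subseteq> sets M" "space M \<in> T" "\<forall>I\<in>T. 0 < emeasure M I" and
    C: "\<forall>I\<in>T. C I \<subseteq> T \<and> finite (C I) \<and> 2 \<le> card (C I) \<and>
        pairwise (almost_disjoint M) (C I) \<and> (\<forall>J\<in>C I. J \<subseteq> I) \<and> I = \<Union>(C I)" and
    lim: "T = (\<Union>m. tree_level (space M) C m)"
      "(\<lambda>m. SUP I\<in>tree_level (space M) C m. emeasure M I) \<longlonglongrightarrow> 0"
    by (elim conjE exE)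
  have "tree_space_axioms M T C"
  proof
    fix I assume "I \<in> T"
    note C' = bspec[OF C this]
    show "0 < emeasure M I" by (rule bspec[OF T(3) \<open>I \<in> T\<close>])
    show "C I \<subseteq> T" "finite (C I)" "2 \<le> card (C I)" "pairwise (almost_disjoint M) (C I)" "I = \<Union>(C I)"
      by (insert C', (elim conjE, assumption)+)
    show "J \<subseteq> I" if "J \<in> C I" for J
      using C' by (elim conjE) (erule bspec, rule that)
  qed (fact T lim)+
  with assms(1) show ?thesis by (intro that[of C]) (simp add: tree_space_def)
qed

text \<open>Levels grow at the bottom by definition; splitting off the first generation instead
  suits inductions that descend from the root.\<close>

lemma tree_level_Suc_start: "tree_level I C (Suc n) = (\<Union>J\<in>C I. tree_level J C n)"
  by (induction n) auto

context tree_space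
begin

lemma T_measurable [measurable_dest, intro]: "I \<in> T \<Longrightarrow> I \<in> sets M"
  using T_sets by auto

lemma level_finite: "finite (tree_level (space M) C n)"
proof (induction n)
  case (Suc n)
  then show ?case using C_finite T_levels by auto
qed auto

lemma countable_T: "countable T"
  unfolding T_levels using level_finite by (intro countable_UN) (auto intro: countable_finite)

lemma C_null: "I \<in> T \<Longrightarrow> J \<in> C I \<Longrightarrow> K \<in> C I \<Longrightarrow> J \<noteq> K \<Longrightarrow> emeasure M (J \<inter> K) = 0"
  using C_disj by (auto simp: pairwise_def almost_disjoint_def)

lemma C_nonempty: "I \<in> T \<Longrightarrow> C I \<noteq> {}"
  using C_card by fastforce

lemma sum_C: assumes "I \<in> T" shows "(\<Sum>J\<in>C I. measure M J) = measure M I"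
proof -
  have "ennreal (measure M I) = emeasure M (\<Union>J\<in>C I. J)"
    using C_Union[OF assms] by (simp add: emeasure_eq_measure)
  also have "\<dots> = (\<Sum>J\<in>C I. emeasure M J)"
    using C_finite[OF assms] C_T[OF assms] C_null[OF assms]
    by (intro emeasure_UN_finite_null_overlap) auto
  finally show ?thesis by (simp add: emeasure_eq_measure sum_nonneg)
qed

lemma null_subset:
  assumes "emeasure M (A \<inter> B) = 0" "A' \<subseteq> A" "B' \<subseteq> B" "A \<in> sets M" "B \<in> sets M"
  shows "emeasure M (A' \<inter> B') = 0"
  using assms emeasure_mono[of "A' \<inter> B'" "A \<inter> B" M] by (metis Int_mono le_zero_eq sets.Int)

text \<open>If \<open>I\<close> has level \<open>l\<close>, then \<open>J n\<close> has level
  \<open>n + l\<close>, so its measure is dominated by the supremum over that level.\<close>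

lemma path_measure_tendsto_0:
  assumes "I \<in> T" "J 0 = I" "\<And>n. J (Suc n) \<in> C (J n)"
  shows "(\<lambda>n. measure M (J n)) \<longlonglongrightarrow> 0"
proof -
  obtain l where l: "I \<in> tree_level (space M) C l" using assms T_levels by auto
  have lev: "J n \<in> tree_level (space M) C (n + l)" for n
    using assms l by (induction n) auto
  have "(\<lambda>n. SUP I\<in>tree_level (space M) C (n + l). emeasure M I) \<longlonglongrightarrow> 0"
    using level_lim by (rule LIMSEQ_ignore_initial_segment)
  then have "(\<lambda>n. emeasure M (J n)) \<longlonglongrightarrow> 0"
    by (rule tendsto_sandwich[OF _ _ tendsto_const, rotated 2])
      (auto intro!: always_eventually SUP_upper lev)
  then have "(\<lambda>n. ennreal (measure M (J n))) \<longlonglongrightarrow> ennreal 0" by (simp add: emeasure_eq_measure)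
  then show ?thesis by (subst (asm) tendsto_ennreal_iff) auto
qed

text \<open>
  Greedy choice along a path \<open>J\<close> in the tree: at each step whole children of \<open>J n\<close> are taken,
  and the remaining target \<open>\<rho> (n + 1)\<close> is passed on to one further child. Since
  \<open>\<rho> n \<le> \<mu>(J n)\<close> tends to 0, the target is hit exactly.
\<close>

lemma subfamily_of_measure:
  assumes I: "I \<in> T" and b: "0 \<le> b" "b \<le> 1"
  shows "\<exists>D. D \<subseteq> T \<and> pairwise (almost_disjoint M) D \<and> \<Union>D \<subseteq> I \<and>
    measure M (\<Union>D) = b * measure M I"
proof -
  \<comment> \<open>A state consists of the current element and the part of the target still to be
    filled, which must fit into that element. \<open>R\<close> records one greedy step: the children
    in \<open>D\<close> are taken whole and the rest of the target moves to
    \<open>J'\<close>.\<close>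
  define P where "P = (\<lambda>(n::nat) (J, \<rho>). J \<in> T \<and> 0 \<le> \<rho> \<and> \<rho> \<le> measure M J \<and>
     (n = 0 \<longrightarrow> J = I \<and> \<rho> = b * measure M I))"
  define R where "R = (\<lambda>(n::nat) (J, \<rho>) (J', \<rho>'). \<exists>D\<subseteq>C J. J' \<in> C J - D \<and> \<rho> = \<rho>' + (\<Sum>K\<in>D. measure M K))"
  have "\<exists>f. \<forall>n. P n (f n) \<and> R n (f n) (f (Suc n))"
  proof (rule dependent_nat_choice)
    show "\<exists>x. P 0 x" unfolding P_def using I b
      by (intro exI[of _ "(I, b * measure M I)"]) (auto simp: mult_left_le_one_le)
  next
    fix x n assume "P n x"
    then obtain J \<rho> where x: "x = (J, \<rho>)" and J: "J \<in> T" "0 \<le> \<rho>" "\<rho> \<le> measure M J"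
      by (cases x) (auto simp: P_def)
    obtain D J' where D: "D \<subseteq> C J" "J' \<in> C J - D" "(\<Sum>K\<in>D. measure M K) \<le> \<rho>"
        "\<rho> \<le> (\<Sum>K\<in>D. measure M K) + measure M J'"
      using greedy_subset_sum[of "C J" \<rho> "measure M"] C_finite C_nonempty sum_C J by metis
    then show "\<exists>y. P (Suc n) y \<and> R n x y"
      using C_T[OF J(1)]
      by (intro exI[of _ "(J', \<rho> - (\<Sum>K\<in>D. measure M K))"]) (auto simp: P_def R_def x)
  qed
  then obtain g where g: "\<And>n. P n (g n)" "\<And>n. R n (g n) (g (Suc n))" by blast
  define J \<rho> where "J = fst \<circ> g" and "\<rho> = snd \<circ> g"
  have JT: "J n \<in> T" and \<rho>: "0 \<le> \<rho> n" "\<rho> n \<le> measure M (J n)" for n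
    using g(1)[of n] by (auto simp: P_def J_def \<rho>_def case_prod_beta)
  have 0: "J 0 = I" "\<rho> 0 = b * measure M I"
    using g(1)[of 0] by (auto simp: P_def J_def \<rho>_def case_prod_beta)
  have "\<exists>D\<subseteq>C (J n). J (Suc n) \<in> C (J n) - D \<and> \<rho> n = \<rho> (Suc n) + (\<Sum>K\<in>D. measure M K)" for n
    using g(2)[of n] by (auto simp: R_def J_def \<rho>_def case_prod_beta)
  then obtain D where D: "\<And>n. D n \<subseteq> C (J n)" "\<And>n. J (Suc n) \<in> C (J n)" "\<And>n. J (Suc n) \<notin> D n"
     "\<And>n. \<rho> n = \<rho> (Suc n) + (\<Sum>K\<in>D n. measure M K)" by (metis DiffE)
  have DT: "D n \<subseteq> T" for n using D(1) C_T JT by blast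
  then have Dset: "K \<in> D n \<Longrightarrow> K \<in> sets M" for K n using T_measurable by blast
  have Dfin: "finite (D n)" for n using D(1) C_finite JT finite_subset by blast
  have "decseq J" using C_sub JT D(2) by (intro decseq_SucI) auto
  then have Jmono: "n \<le> m \<Longrightarrow> J m \<subseteq> J n" for n m by (auto simp: decseq_def)
  have DJ: "K \<in> D n \<Longrightarrow> K \<subseteq> J n" for K n using D(1) C_sub JT by blast
  have U_sets: "\<Union>(D n) \<in> sets M" for n using DT Dfin by (meson T_measurable countable_finite sets.countable_Union subset_iff subsetI)
  \<comment> \<open>Later choices lie in \<open>J (Suc n)\<close>, a child of \<open>J n\<close>
    that was not taken into \<open>D n\<close>.\<close>
  have cross: "emeasure M (K \<inter> K') = 0" if "n < m" "K \<in> D n" "K' \<in> D m" for n m K K'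
  proof (rule null_subset[of _ "J (Suc n)"])
    show "emeasure M (K \<inter> J (Suc n)) = 0"
      using D that by (intro C_null[OF JT]) auto
    show "K' \<subseteq> J (Suc n)" using DJ[OF that(3)] Jmono[of "Suc n" m] that by auto
  qed (use that DT JT in auto)
  have same: "emeasure M (K \<inter> K') = 0" if "K \<noteq> K'" "K \<in> D n" "K' \<in> D n" for n K K'
    using that D(1) JT by (intro C_null[OF JT]) auto
  have crossU: "emeasure M (\<Union>(D n) \<inter> \<Union>(D m)) = 0" if "n < m" for n m
  proof -
    have "\<Union>(D n) \<inter> \<Union>(D m) = (\<Union>K\<in>D n. \<Union>K'\<in>D m. K \<inter> K')" by auto
    also have "\<dots> \<in> null_sets M"
      using cross[OF that] Dfin Dset
      by (intro null_sets_UN' null_setsI countable_finite sets.Int) auto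
    finally show ?thesis by auto
  qed
  have meas: "emeasure M (\<Union>(D n)) = ennreal (\<rho> n - \<rho> (Suc n))" for n
  proof -
    have "emeasure M (\<Union>K\<in>D n. K) = (\<Sum>K\<in>D n. emeasure M K)"
      using Dfin DT same by (intro emeasure_UN_finite_null_overlap) auto
    then show ?thesis using D(4)[of n] by (simp add: emeasure_eq_measure sum_nonneg)
  qed
  have dec: "\<rho> (Suc n) \<le> \<rho> n" for n using D(4)[of n] by (simp add: sum_nonneg)
  have "\<rho> \<longlonglongrightarrow> 0"
    by (rule tendsto_sandwich[OF _ _ tendsto_const path_measure_tendsto_0[OF I 0(1) D(2)]]) (auto simp: \<rho>)
  then have sums: "(\<lambda>n. \<rho> n - \<rho> (Suc n)) sums (\<rho> 0 - 0)" by (rule telescope_sums')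
  have "emeasure M (\<Union>n. \<Union>(D n)) = (\<integral>\<^sup>+n. emeasure M (\<Union>(D n)) \<partial>count_space UNIV)"
    using U_sets crossU by (intro emeasure_UN_null_overlap) (auto, metis Int_commute linorder_neqE_nat)
  also have "\<dots> = (\<Sum>n. ennreal (\<rho> n - \<rho> (Suc n)))"
    by (simp add: nn_integral_count_space_nat meas)
  also have "\<dots> = ennreal (\<rho> 0)"
    using sums dec by (intro suminf_ennreal_eq) auto
  finally have "measure M (\<Union>n. \<Union>(D n)) = \<rho> 0" using \<rho>(1)[of 0] by (simp add: emeasure_eq_measure)
  moreover have "(\<Union>n. \<Union>(D n)) = \<Union>(\<Union>n. D n)" by auto
  moreover have "pairwise (almost_disjoint M) (\<Union>n. D n)"
    unfolding pairwise_def almost_disjoint_def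
    by (intro ballI impI, elim UN_E) (metis cross same Int_commute linorder_neqE_nat)
  moreover have "\<Union>(\<Union>n. D n) \<subseteq> I" using DJ Jmono[of 0] 0 by fastforce
  moreover have "(\<Union>n. D n) \<subseteq> T" using DT by blast
  ultimately show ?thesis using 0(2)
    by (intro exI[of _ "\<Union>n. D n"]) simp
qed

end

section \<open>The weak type inequality\<close>

context tree_space
begin

text \<open>
  Descending from \<open>I\<close> and stopping at the first elements that satisfy \<open>P\<close> makes the selected
  elements almost disjoint, without a choice of maximal elements.
\<close>

primrec good_union :: "('a set \<Rightarrow> bool) \<Rightarrow> nat \<Rightarrow> 'a set \<Rightarrow> 'a set" where
  "good_union P 0 I = (if P I then I else {})"
| "good_union P (Suc n) I = (if P I then I else (\<Union>J\<in>C I. good_union P n J))"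

lemma good_union_subset: "I \<in> T \<Longrightarrow> good_union P n I \<subseteq> I"
proof (induction n arbitrary: I)
  case (Suc n)
  then show ?case using C_T C_sub by (auto simp: subset_iff)
qed auto

lemma good_union_sets: "I \<in> T \<Longrightarrow> good_union P n I \<in> sets M"
proof (induction n arbitrary: I)
  case (Suc n)
  then show ?case using C_T C_finite by (auto intro!: sets.finite_UN)
qed auto

lemma good_union_mono: "I \<in> T \<Longrightarrow> good_union P n I \<subseteq> good_union P (Suc n) I"
proof (induction n arbitrary: I)
  case 0
  then show ?case by auto
next
  case (Suc n)
  have "good_union P n J \<subseteq> good_union P (Suc n) J" if "J \<in> C I" for J
    using Suc C_T that by blast
  then show ?case by (auto simp del: good_union.simps(2) simp: good_union.simps(2)[of P _ I]) 
qed

text \<open>Either the descent stops at an ancestor of \<open>J\<close>, which contains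
  \<open>J\<close>, or it reaches \<open>J\<close> itself at depth \<open>n\<close>.\<close>

lemma good_subset_good_union:
  "I \<in> T \<Longrightarrow> J \<in> tree_level I C n \<Longrightarrow> P J \<Longrightarrow> J \<subseteq> good_union P n I"
proof (induction n arbitrary: I)
  case (Suc n)
  have "J \<subseteq> I"
  proof -
    have "\<forall>K\<in>tree_level I C m. K \<subseteq> I \<and> K \<in> T" for m
      using Suc.prems(1) by (induction m) (use C_T C_sub in fastforce)+
    then show ?thesis using Suc.prems(2) by blast
  qed
  obtain K where K: "K \<in> C I" "J \<in> tree_level K C n"
    using Suc.prems(2) unfolding tree_level_Suc_start by auto
  then have "J \<subseteq> good_union P n K" using Suc C_T by blast
  then show ?case using K \<open>J \<subseteq> I\<close> by auto
qed auto

text \<open>Replaces the overlapping family of all good elements by the stopped unions, which can be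
  estimated by induction on the depth.\<close>

lemma Union_good: "\<Union>{I\<in>T. P I} = (\<Union>n. good_union P n (space M))"
proof
  show "\<Union>{I\<in>T. P I} \<subseteq> (\<Union>n. good_union P n (space M))"
  proof (rule Union_least)
    fix I assume I: "I \<in> {I\<in>T. P I}"
    then obtain n where "I \<in> tree_level (space M) C n" using T_levels by blast
    then have "I \<subseteq> good_union P n (space M)"
      using good_subset_good_union[OF space_T] I by blast
    then show "I \<subseteq> (\<Union>n. good_union P n (space M))" by blast
  qed
  have "good_union P n I \<subseteq> \<Union>{I\<in>T. P I}" if "I \<in> T" for n I
    using that
  proof (induction n arbitrary: I)
    case (Suc n)
    then show ?case using C_T by (auto simp: subset_iff)
  qed auto
  then show "(\<Union>n. good_union P n (space M)) \<subseteq> \<Union>{I\<in>T. P I}" using space_T by blast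
qed

text \<open>Both sides are additive over the children of \<open>I\<close>, because the stopped
  unions inside distinct children overlap in null sets only; so the inequality is inherited from the
  elements where the descent stops.\<close>

lemma good_union_weak_type:
  assumes [measurable]: "\<phi> \<in> borel_measurable M"
    and P: "\<And>I. I \<in> T \<Longrightarrow> P I \<Longrightarrow> s * emeasure M I \<le> (\<integral>\<^sup>+x\<in>I. \<phi> x \<partial>M)"
  shows "I \<in> T \<Longrightarrow> s * emeasure M (good_union P n I) \<le> (\<integral>\<^sup>+x\<in>good_union P n I. \<phi> x \<partial>M)"
proof (induction n arbitrary: I)
  case 0
  then show ?case using P by auto
next
  case (Suc n)
  show ?case
  proof (cases "P I")
    case True
    then show ?thesis using P Suc by auto
  next
    case False
    let ?U = "\<lambda>J. good_union P n J"
    have JT: "J \<in> T" if "J \<in> C I" for J using that C_T Suc.prems by auto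
    have sets: "?U J \<in> sets M" if "J \<in> C I" for J using that JT good_union_sets by auto
    have null: "emeasure M (?U J \<inter> ?U K) = 0" if "J \<in> C I" "K \<in> C I" "J \<noteq> K" for J K
      by (rule null_subset[OF C_null[OF Suc.prems that] good_union_subset good_union_subset])
        (use JT that in blast)+
    \<comment> \<open>The right-hand side is read as a measure with density \<phi>, for which the
      overlaps are null as well.\<close>
    have null': "emeasure (density M \<phi>) (?U J \<inter> ?U K) = 0" if "J \<in> C I" "K \<in> C I" "J \<noteq> K" for J K
      using null[OF that] sets that
      by (subst emeasure_density) (auto intro!: nn_integral_null_set)
    have "s * emeasure M (good_union P (Suc n) I) = s * (\<Sum>J\<in>C I. emeasure M (?U J))"
      using False sets null C_finite[OF Suc.prems] by (simp add: emeasure_UN_finite_null_overlap)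
    also have "\<dots> = (\<Sum>J\<in>C I. s * emeasure M (?U J))"
      by (simp add: sum_distrib_left)
    also have "\<dots> \<le> (\<Sum>J\<in>C I. emeasure (density M \<phi>) (?U J))"
      using Suc.IH JT sets by (intro sum_mono) (simp add: emeasure_density)
    also have "\<dots> = emeasure (density M \<phi>) (\<Union>J\<in>C I. ?U J)"
      using sets null' C_finite[OF Suc.prems] by (intro emeasure_UN_finite_null_overlap[symmetric]) auto
    also have "\<dots> = (\<integral>\<^sup>+x\<in>good_union P (Suc n) I. \<phi> x \<partial>M)"
      using False sets C_finite[OF Suc.prems] by (subst emeasure_density) auto
    finally show ?thesis .
  qed
qed

section \<open>Superlevel sets of the maximal operator\<close>

lemma maximal_op_superlevel:
  "{x\<in>space M. s < maximal_op M T \<phi> x} =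
    \<Union>{I\<in>T. s < (\<integral>\<^sup>+y\<in>I. ennreal \<bar>\<phi> y\<bar> \<partial>M) / emeasure M I}"
  using sets.sets_into_space[OF T_measurable] by (auto simp: maximal_op_def less_SUP_iff)

lemma maximal_op_measurable [measurable]: "maximal_op M T \<phi> \<in> borel_measurable M"
proof (rule borel_measurableI_greater)
  fix s :: ennreal
  have "countable {I\<in>T. s < (\<integral>\<^sup>+y\<in>I. ennreal \<bar>\<phi> y\<bar> \<partial>M) / emeasure M I}"
    using countable_T by (rule countable_subset[rotated]) auto
  then show "{x\<in>space M. s < maximal_op M T \<phi> x} \<in> sets M"
    unfolding maximal_op_superlevel by (intro sets.countable_Union) auto
qed

text \<open>The inequality with constant 1 passes from the stopped unions to \<open>E s\<close>,
  which they exhaust increasingly.\<close>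

lemma maximal_op_weak_type:
  assumes \<phi>[measurable]: "\<phi> \<in> borel_measurable M"
  defines "E \<equiv> \<lambda>s. {x\<in>space M. s < maximal_op M T \<phi> x}"
  shows "s * emeasure M (E s) \<le> (\<integral>\<^sup>+x\<in>E s. ennreal \<bar>\<phi> x\<bar> \<partial>M)"
proof -
  define P where "P I \<longleftrightarrow> s < (\<integral>\<^sup>+y\<in>I. ennreal \<bar>\<phi> y\<bar> \<partial>M) / emeasure M I" for I
  have E: "E s = (\<Union>n. good_union P n (space M))"
    unfolding E_def maximal_op_superlevel P_def[symmetric] Union_good ..
  have P: "s * emeasure M I \<le> (\<integral>\<^sup>+x\<in>I. ennreal \<bar>\<phi> x\<bar> \<partial>M)" if "I \<in> T" "P I" for I
  proof -
    have "s * emeasure M I \<le> (\<integral>\<^sup>+y\<in>I. ennreal \<bar>\<phi> y\<bar> \<partial>M) / emeasure M I * emeasure M I"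
      using that by (intro mult_right_mono) (auto simp: P_def)
    also have "\<dots> = (\<integral>\<^sup>+y\<in>I. ennreal \<bar>\<phi> y\<bar> \<partial>M)"
      using T_pos[OF that(1)] by (simp add: ennreal_divide_times ennreal_divide_self emeasure_eq_measure)
    finally show ?thesis .
  qed
  have inc: "incseq (\<lambda>n. good_union P n (space M))"
    using good_union_mono[OF space_T] by (rule incseq_SucI)
  have "s * emeasure M (E s) = s * (SUP n. emeasure M (good_union P n (space M)))"
    unfolding E using inc good_union_sets[OF space_T] by (subst SUP_emeasure_incseq) auto
  also have "\<dots> = (SUP n. s * emeasure M (good_union P n (space M)))"
    by (rule SUP_mult_left_ennreal)
  also have "\<dots> \<le> (\<integral>\<^sup>+x\<in>E s. ennreal \<bar>\<phi> x\<bar> \<partial>M)"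
  proof (rule SUP_least)
    fix n
    have "s * emeasure M (good_union P n (space M)) \<le> (\<integral>\<^sup>+x\<in>good_union P n (space M). ennreal \<bar>\<phi> x\<bar> \<partial>M)"
      using P by (intro good_union_weak_type space_T) auto
    also have "\<dots> \<le> (\<integral>\<^sup>+x\<in>E s. ennreal \<bar>\<phi> x\<bar> \<partial>M)"
      unfolding E by (intro nn_integral_mono) (auto simp: indicator_def)
    finally show "s * emeasure M (good_union P n (space M)) \<le> (\<integral>\<^sup>+x\<in>E s. ennreal \<bar>\<phi> x\<bar> \<partial>M)" .
  qed
  finally show ?thesis .
qed

end

text \<open>Layer cake: the integral over \<open>A\<close> is the integral over t > 0 of the measure
  of the part of \<open>A\<close> where \<phi> exceeds t. That measure is at most \<mu>(A) and at
  most (c / t)^p, and each bound is used where it is the smaller one.\<close>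

lemma (in finite_measure) nn_integral_weak_tail_le:
  fixes c p :: real
  assumes [measurable]: "\<phi> \<in> borel_measurable M" "A \<in> sets M" and "0 < c" "1 < p"
    and nn: "\<And>x. x \<in> space M \<Longrightarrow> 0 \<le> \<phi> x"
    and tail: "\<And>l. 0 < l \<Longrightarrow> measure M {x\<in>space M. l < \<phi> x} \<le> (c / l) powr p"
    and pos: "0 < measure M A"
  shows "(\<integral>\<^sup>+x\<in>A. ennreal (\<phi> x) \<partial>M) \<le> ennreal (p / (p - 1) * c * measure M A powr (1 - 1 / p))"
proof -
  interpret P: pair_sigma_finite lborel M ..
  let ?m = "measure M A"
  \<comment> \<open>The level at which the two bounds \<mu>(A) and (c / t)^p coincide.\<close>
  define l where "l = c * ?m powr (- 1 / p)"
  have l: "0 < l" using assms by (simp add: l_def)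
  let ?g = "\<lambda>z::real\<times>'a. indicator {0<..} (fst z) * indicator {z. fst z < \<phi> (snd z)} z * indicator A (snd z) :: ennreal"
  have [measurable]: "?g \<in> borel_measurable (lborel \<Otimes>\<^sub>M M)"
    by (measurable)
  have "(\<integral>\<^sup>+x\<in>A. ennreal (\<phi> x) \<partial>M) = (\<integral>\<^sup>+x. \<integral>\<^sup>+t. ?g (t, x) \<partial>lborel \<partial>M)"
  proof (rule nn_integral_cong)
    fix x assume "x \<in> space M"
    have "(\<integral>\<^sup>+t. ?g (t, x) \<partial>lborel) = (\<integral>\<^sup>+t. indicator A x * indicator {0<..<\<phi> x} t \<partial>lborel)"
      by (intro nn_integral_cong) (auto simp: indicator_def)
    also have "\<dots> = ennreal (\<phi> x) * indicator A x"
      using nn[OF \<open>x \<in> space M\<close>] by (subst nn_integral_cmult) (auto simp: mult.commute)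
    finally show "ennreal (\<phi> x) * indicator A x = (\<integral>\<^sup>+t. ?g (t, x) \<partial>lborel)" ..
  qed
  also have "\<dots> = (\<integral>\<^sup>+t. \<integral>\<^sup>+x. ?g (t, x) \<partial>M \<partial>lborel)"
    by (intro P.Fubini) simp
  also have "\<dots> \<le> (\<integral>\<^sup>+t. ennreal ?m * indicator {0..l} t + ennreal ((c / t) powr p) * indicator {l..} t \<partial>lborel)"
  proof (rule nn_integral_mono)
    fix t :: real
    have eq: "(\<integral>\<^sup>+x. ?g (t, x) \<partial>M) = indicator {0<..} t * emeasure M ({x\<in>space M. t < \<phi> x} \<inter> A)"
      by (subst nn_integral_indicator[symmetric], measurable, subst nn_integral_cmult[symmetric])
         (auto intro!: nn_integral_cong simp: indicator_def)
    have 1: "measure M ({x\<in>space M. t < \<phi> x} \<inter> A) \<le> ?m" by (intro finite_measure_mono) auto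
    have 2: "measure M ({x\<in>space M. t < \<phi> x} \<inter> A) \<le> (c / t) powr p" if "0 < t"
      by (rule order_trans[OF finite_measure_mono tail]) (use that in auto)
    show "(\<integral>\<^sup>+x. ?g (t, x) \<partial>M) \<le> ennreal ?m * indicator {0..l} t + ennreal ((c / t) powr p) * indicator {l..} t"
      unfolding eq using 1 2 l
      by (auto simp: indicator_def emeasure_eq_measure ennreal_leI add_increasing2 simp flip: ennreal_plus)
  qed
  also have "\<dots> = ennreal ?m * emeasure lborel {0..l} + (\<integral>\<^sup>+t. ennreal ((c / t) powr p) * indicator {l..} t \<partial>lborel)"
    by (subst nn_integral_add) (auto simp: nn_integral_cmult)
  also have "(\<integral>\<^sup>+t. ennreal ((c / t) powr p) * indicator {l..} t \<partial>lborel) =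
      (\<integral>\<^sup>+t. ennreal (c powr p * t powr (- p)) * indicator {l..} t \<partial>lborel)"
    using l \<open>0 < c\<close> by (intro nn_integral_cong) (auto simp: indicator_def powr_divide powr_minus_divide)
  also have "\<dots> = ennreal (0 - c powr p * (l powr (1 - p) / (1 - p)))"
  proof (rule nn_integral_FTC_atLeast)
    fix x assume "l \<le> x"
    then show "((\<lambda>x. c powr p * (x powr (1 - p) / (1 - p))) has_real_derivative c powr p * x powr (- p)) (at x)"
      using l \<open>1 < p\<close> by (auto intro!: derivative_eq_intros)
  next
    have "((\<lambda>x::real. x powr (1 - p)) \<longlongrightarrow> 0) at_top"
      using \<open>1 < p\<close> by (intro tendsto_neg_powr filterlim_ident) auto
    from tendsto_mult[OF tendsto_const[of "c powr p"] tendsto_divide[OF this tendsto_const[of "1 - p"]]]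
    show "((\<lambda>x. c powr p * (x powr (1 - p) / (1 - p))) \<longlongrightarrow> 0) at_top"
      using \<open>1 < p\<close> by simp
  qed auto
  also have "0 - c powr p * (l powr (1 - p) / (1 - p)) = c powr p * (l powr (1 - p) / (p - 1))"
    using minus_divide_right[of "c powr p * l powr (1 - p)" "1 - p"] by simp
  also have "ennreal ?m * emeasure lborel {0..l} + ennreal (c powr p * (l powr (1 - p) / (p - 1))) =
      ennreal (?m * l + c powr p * (l powr (1 - p) / (p - 1)))"
    using l \<open>1 < p\<close> by (simp flip: ennreal_mult ennreal_plus)
  also have "?m * l = c * ?m powr (1 - 1 / p)"
    using pos by (simp add: l_def powr_diff powr_minus_divide)
  also have "c powr p * (l powr (1 - p) / (p - 1)) = c * ?m powr (1 - 1 / p) / (p - 1)"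
  proof -
    have "l powr (1 - p) = c powr (1 - p) * ?m powr (1 - 1 / p)"
    proof -
      have "- 1 / p * (1 - p) = 1 - 1 / p" using \<open>1 < p\<close> by (simp add: field_simps)
      then show ?thesis using assms by (simp only: l_def powr_mult powr_powr)
    qed
    moreover have "c powr p * c powr (1 - p) = c" using \<open>0 < c\<close> by (simp flip: powr_add)
    ultimately show ?thesis by (metis (no_types, opaque_lifting) mult.assoc times_divide_eq_right)
  qed
  also have "c * ?m powr (1 - 1 / p) + c * ?m powr (1 - 1 / p) / (p - 1) = p / (p - 1) * c * ?m powr (1 - 1 / p)"
    using \<open>1 < p\<close> by (simp add: field_simps)
  finally show ?thesis .
qed

section \<open>Rearrangements and ladders of tree elements\<close>

lemma rearrangement_le:
  "emeasure M {x\<in>space M. s < \<psi> x} \<le> ennreal t \<Longrightarrow> rearrangement M \<psi> t \<le> s"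
  unfolding rearrangement_def by (intro Inf_lower) auto

lemma le_rearrangement:
  "(\<And>s. s < u \<Longrightarrow> ennreal t < emeasure M {x\<in>space M. s < \<psi> x}) \<Longrightarrow> u \<le> rearrangement M \<psi> t"
  unfolding rearrangement_def by (intro Inf_greatest) (auto simp: not_less[symmetric])

text \<open>Turns the quasinorm into a tail estimate, the form needed both for the layer cake bound
  and for computing the norm of step functions.\<close>

lemma (in prob_space) weak_lorentz_norm_le_iff:
  assumes [measurable]: "\<phi> \<in> borel_measurable M" and "0 < c" "0 < p"
  shows "weak_lorentz_norm M p (\<lambda>x. ennreal \<bar>\<phi> x\<bar>) \<le> ennreal c \<longleftrightarrow>
    (\<forall>l>0. measure M {x\<in>space M. l < \<bar>\<phi> x\<bar>} \<le> (c / l) powr p)"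
proof safe
  fix l :: real assume W: "weak_lorentz_norm M p (\<lambda>x. ennreal \<bar>\<phi> x\<bar>) \<le> ennreal c" and l: "0 < l"
  show "measure M {x\<in>space M. l < \<bar>\<phi> x\<bar>} \<le> (c / l) powr p"
  proof (rule ccontr)
    assume "\<not> ?thesis"
    \<comment> \<open>For such t the rearrangement at t is at least l, while t^(1/p) l exceeds
      c.\<close>
    then obtain t where t: "(c / l) powr p < t" "t < measure M {x\<in>space M. l < \<bar>\<phi> x\<bar>}"
      by (meson dense not_le)
    have "0 < t" using t(1) by (meson le_less_trans powr_ge_zero)
    have "t \<le> 1" using t(2) prob_le_1[of "{x\<in>space M. l < \<bar>\<phi> x\<bar>}"] by linarith
    have "ennreal l \<le> rearrangement M (\<lambda>x. ennreal \<bar>\<phi> x\<bar>) t"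
    proof (rule le_rearrangement)
      fix s assume s: "s < ennreal l"
      have "ennreal t < emeasure M {x\<in>space M. l < \<bar>\<phi> x\<bar>}"
        using t \<open>0 < t\<close> by (simp add: emeasure_eq_measure ennreal_less_iff)
      also have "\<dots> \<le> emeasure M {x\<in>space M. s < ennreal \<bar>\<phi> x\<bar>}"
        using s by (intro emeasure_mono) (auto elim!: less_le_trans intro!: ennreal_leI)
      finally show "ennreal t < emeasure M {x\<in>space M. s < ennreal \<bar>\<phi> x\<bar>}" .
    qed
    then have "ennreal (t powr (1 / p)) * ennreal l \<le>
        ennreal (t powr (1 / p)) * rearrangement M (\<lambda>x. ennreal \<bar>\<phi> x\<bar>) t"
      by (intro mult_left_mono) auto
    also have "\<dots> \<le> ennreal c"
      using W \<open>0 < t\<close> \<open>t \<le> 1\<close> by (auto simp: weak_lorentz_norm_def SUP_le_iff)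
    finally have "t powr (1 / p) * l \<le> c"
      using assms l by (simp flip: ennreal_mult)
    then have "t powr (1 / p) \<le> c / l" using l by (simp add: field_simps)
    then have "(t powr (1 / p)) powr p \<le> (c / l) powr p"
      using assms by (intro powr_mono2) auto
    then show False using t(1) \<open>0 < t\<close> \<open>0 < p\<close> by (simp add: powr_powr)
  qed
next
  assume tail: "\<forall>l>0. measure M {x\<in>space M. l < \<bar>\<phi> x\<bar>} \<le> (c / l) powr p"
  show "weak_lorentz_norm M p (\<lambda>x. ennreal \<bar>\<phi> x\<bar>) \<le> ennreal c"
    unfolding weak_lorentz_norm_def
  proof (rule SUP_least)
    fix t :: real assume "t \<in> {0<..1}"
    then have t: "0 < t" by simp
    \<comment> \<open>The level whose tail bound (c / s)^p is exactly t.\<close>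
    define s where "s = c * t powr (- 1 / p)"
    have s: "0 < s" using assms t by (simp add: s_def)
    have "c / s = t powr (1 / p)" using assms t by (simp add: s_def powr_minus_divide field_simps)
    then have "(c / s) powr p = t" using t assms by (simp add: powr_powr)
    then have "measure M {x\<in>space M. s < \<bar>\<phi> x\<bar>} \<le> t" using tail s by metis
    then have "rearrangement M (\<lambda>x. ennreal \<bar>\<phi> x\<bar>) t \<le> ennreal s"
      using s by (intro rearrangement_le) (simp add: ennreal_less_iff emeasure_eq_measure ennreal_leI)
    then have "ennreal (t powr (1 / p)) * rearrangement M (\<lambda>x. ennreal \<bar>\<phi> x\<bar>) t \<le> ennreal (t powr (1 / p)) * ennreal s"
      by (intro mult_left_mono) auto
    also have "\<dots> = ennreal c"
      using t assms by (simp add: s_def powr_minus_divide flip: ennreal_mult)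
    finally show "ennreal (t powr (1 / p)) * rearrangement M (\<lambda>x. ennreal \<bar>\<phi> x\<bar>) t \<le> ennreal c" .
  qed
qed

text \<open>\<open>E_cover\<close> is the property that matters: around each point of
  \<open>E k\<close> there is a tree element that meets all deeper layers in the same proportions as
  \<open>E k\<close> does, so averages over \<open>E k\<close> become averages over tree
  elements.\<close>

locale tree_ladder = tree_space +
  fixes \<beta> :: real and E :: "nat \<Rightarrow> 'a set"
  assumes \<beta>: "0 < \<beta>" "\<beta> < 1"
    and E_decseq: "decseq E"
    and E_sets [measurable]: "\<And>k. E k \<in> sets M"
    and E_measure: "\<And>k. measure M (E k) = \<beta> ^ k"
    and E_cover: "\<And>k x. x \<in> E k \<Longrightarrow>
      \<exists>J\<in>T. x \<in> J \<and> J \<subseteq> E k \<and> (\<forall>i. measure M (J \<inter> E (k + i)) = \<beta> ^ i * measure M J)"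
    and E_0: "E 0 = space M"

text \<open>Choose in each tree element \<open>I\<close> a subfamily \<open>S I\<close> filling the
  fraction \<beta> of it, and iterate from the whole space: \<open>D k\<close> is the family of
  elements that make up \<open>E k\<close>.\<close>

lemma (in tree_space) ladder_exists:
  assumes b: "0 < \<beta>" "\<beta> < 1"
  shows "\<exists>E. tree_ladder M T C \<beta> E"
proof -
  have "\<exists>D. D \<subseteq> T \<and> pairwise (almost_disjoint M) D \<and> \<Union>D \<subseteq> I \<and>
    measure M (\<Union>D) = \<beta> * measure M I" if "I \<in> T" for I
    using subfamily_of_measure[OF that, of \<beta>] b by simp
  then obtain S where S: "\<And>I. I \<in> T \<Longrightarrow> S I \<subseteq> T" "\<And>I. I \<in> T \<Longrightarrow> pairwise (almost_disjoint M) (S I)"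
    "\<And>I. I \<in> T \<Longrightarrow> \<Union>(S I) \<subseteq> I" "\<And>I. I \<in> T \<Longrightarrow> measure M (\<Union>(S I)) = \<beta> * measure M I"
    by metis
  define D where "D = rec_nat {space M} (\<lambda>_ A. \<Union>J\<in>A. S J)"
  have D0: "D 0 = {space M}" and DS: "D (Suc k) = (\<Union>J\<in>D k. S J)" for k by (simp_all add: D_def)
  have DT: "D k \<subseteq> T" for k
    using space_T S(1) by (induction k) (auto simp: D0 DS)
  have D_countable: "countable (D k)" for k
    using DT countable_T countable_subset by blast
  have S_countable: "countable (S J)" if "J \<in> T" for J
    using S(1)[OF that] countable_T countable_subset by blast
  have D_sets: "J \<in> sets M" if "J \<in> D k" for J k using DT that by blast
  have D_null: "J \<in> D k \<Longrightarrow> K \<in> D k \<Longrightarrow> J \<noteq> K \<Longrightarrow> emeasure M (J \<inter> K) = 0" for k J K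
  proof (induction k arbitrary: J K)
    case (Suc k)
    then obtain J' K' where J: "J' \<in> D k" "J \<in> S J'" and K: "K' \<in> D k" "K \<in> S K'" by (auto simp: DS)
    have T: "J' \<in> T" "K' \<in> T" using J K DT by auto
    show ?case
    proof (cases "J' = K'")
      case True
      then show ?thesis using S(2)[OF T(1)] J K Suc.prems by (auto simp: pairwise_def almost_disjoint_def)
    next
      case False
      then show ?thesis
        using S(3)[OF T(1)] S(3)[OF T(2)] J K T by (intro null_subset[OF Suc.IH[OF J(1) K(1)]]) auto
    qed
  qed (simp add: D0)
  define E where "E k = \<Union>(D k)" for k
  have E_sets: "E k \<in> sets M" for k
    unfolding E_def using D_countable D_sets by (intro sets.countable_Union) auto
  have "decseq E"
    using S(3) DT by (intro decseq_SucI) (fastforce simp: E_def DS)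
  then have E_mono: "k \<le> m \<Longrightarrow> E m \<subseteq> E k" for k m by (auto simp: decseq_def)
  \<comment> \<open>Induction on \<open>i\<close> with \<open>k\<close> and \<open>J\<close>
    arbitrary: the pieces in \<open>S J\<close> belong to \<open>D (Suc k)\<close>, each keeps the
    fraction \<beta>^i of its measure, and together they fill the fraction \<beta> of
    \<open>J\<close>.\<close>
  have main: "J \<in> D k \<Longrightarrow> emeasure M (J \<inter> E (k + i)) = ennreal (\<beta> ^ i) * emeasure M J" for i k J
  proof (induction i arbitrary: k J)
    case 0
    then have "J \<inter> E k = J" by (auto simp: E_def)
    then show ?case by simp
  next
    case (Suc i)
    have JT: "J \<in> T" using Suc.prems DT by auto
    let ?U = "\<Union>K\<in>S J. K \<inter> E (Suc k + i)"
    \<comment> \<open>A point of \<open>J\<close> in a deeper layer may have been selected inside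
      another member of \<open>D k\<close>; such points lie in the null set
      \<open>N\<close>.\<close>
    define N where "N = (\<Union>J'\<in>D k - {J}. J \<inter> J')"
    have SD: "K \<in> D (Suc k)" if "K \<in> S J" for K using Suc.prems that by (auto simp: DS)
    have N: "N \<in> null_sets M"
      unfolding N_def using D_countable Suc.prems D_null D_sets
      by (intro null_sets_UN' null_setsI) (auto intro!: sets.Int)
    have U_sets: "?U \<in> sets M"
      using S_countable[OF JT] SD D_sets E_sets by (intro sets.countable_UN' sets.Int) auto
    have sub: "?U \<subseteq> J \<inter> E (Suc k + i)" using S(3)[OF JT] by auto
    have "J \<inter> E (Suc k + i) \<subseteq> ?U \<union> N"
    proof
      fix x assume x: "x \<in> J \<inter> E (Suc k + i)"
      then have "x \<in> E (Suc k)" using E_mono[of "Suc k" "Suc k + i"] by auto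
      then obtain J' K where K: "J' \<in> D k" "K \<in> S J'" "x \<in> K" by (auto simp: E_def DS)
      moreover have "x \<in> J'" using S(3)[of J'] K DT by auto
      ultimately show "x \<in> ?U \<union> N" using x unfolding N_def by (cases "J' = J") auto
    qed
    then have "emeasure M (J \<inter> E (Suc k + i)) \<le> emeasure M (?U \<union> N)"
      using U_sets N by (intro emeasure_mono) auto
    also have "\<dots> = emeasure M ?U" using U_sets N by (rule emeasure_Un_null_set)
    finally have "emeasure M (J \<inter> E (Suc k + i)) = emeasure M ?U"
      using emeasure_mono[OF sub sets.Int[OF D_sets[OF Suc.prems] E_sets]] by (rule antisym)
    also have "\<dots> = (\<integral>\<^sup>+K. emeasure M (K \<inter> E (Suc k + i)) \<partial>count_space (S J))"
    proof (rule emeasure_UN_null_overlap)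
      fix K K' assume K: "K \<in> S J" "K' \<in> S J" "K \<noteq> K'"
      show "emeasure M (K \<inter> E (Suc k + i) \<inter> (K' \<inter> E (Suc k + i))) = 0"
        using K SD D_sets by (intro null_subset[OF D_null[OF SD SD]]) auto
    qed (use S_countable JT SD D_sets E_sets in auto)
    also have "\<dots> = (\<integral>\<^sup>+K. ennreal (\<beta> ^ i) * emeasure M K \<partial>count_space (S J))"
      by (intro nn_integral_cong) (metis Suc.IH SD space_count_space)
    also have "\<dots> = ennreal (\<beta> ^ i) * (\<integral>\<^sup>+K. emeasure M K \<partial>count_space (S J))"
      by (intro nn_integral_cmult) simp
    also have "(\<integral>\<^sup>+K. emeasure M K \<partial>count_space (S J)) = emeasure M (\<Union>K\<in>S J. K)"
      using S_countable JT SD D_sets D_null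
      by (intro emeasure_UN_null_overlap[symmetric]) blast+
    also have "\<dots> = ennreal \<beta> * emeasure M J"
      using S(4)[OF JT] b by (simp add: emeasure_eq_measure ennreal_mult)
    finally show ?case using b by (simp add: ennreal_mult mult_ac)
  qed
  have main': "measure M (J \<inter> E (k + i)) = \<beta> ^ i * measure M J" if "J \<in> D k" for i k J
    using main[OF that, of i] b by (simp add: emeasure_eq_measure flip: ennreal_mult)
  have E0: "E 0 = space M" by (simp add: E_def D0)
  have "tree_ladder_axioms M T \<beta> E"
  proof
    show "measure M (E k) = \<beta> ^ k" for k
      using main'[of "space M" 0 k] sets.sets_into_space[OF E_sets, of k] by (simp add: D0 prob_space Int_absorb1)
    show "\<exists>J\<in>T. x \<in> J \<and> J \<subseteq> E k \<and> (\<forall>i. measure M (J \<inter> E (k + i)) = \<beta> ^ i * measure M J)"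
      if x: "x \<in> E k" for k x
    proof -
      obtain J where "J \<in> D k" "x \<in> J" using x by (auto simp: E_def)
      then show ?thesis using DT main' by (intro bexI[of _ J]) (auto simp: E_def)
    qed
  qed fact+
  then have "tree_ladder M T C \<beta> E" using tree_space_axioms by (simp add: tree_ladder_def)
  then show ?thesis by (intro exI[of _ E])
qed

section \<open>Step functions on a ladder\<close>

context tree_ladder
begin

text \<open>At each point at most one term is nonzero; the series form gives measurability and
  termwise integration. Points lying in every \<open>E i\<close> get the value 0.\<close>

definition step_fun :: "(nat \<Rightarrow> real) \<Rightarrow> 'a \<Rightarrow> real" where
  "step_fun c x = (\<Sum>i. c i * indicator (E i - E (Suc i)) x)"

lemma E_mono: "k \<le> m \<Longrightarrow> E m \<subseteq> E k"
  using E_decseq by (auto simp: decseq_def)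

lemma ring_unique: "x \<in> E i - E (Suc i) \<Longrightarrow> x \<in> E j - E (Suc j) \<Longrightarrow> i = j"
  using E_mono[of "Suc i" j] E_mono[of "Suc j" i] by (cases i j rule: linorder_cases) auto

lemma step_fun_sums:
  "(\<lambda>i. c i * indicator (E i - E (Suc i)) x) sums step_fun c x"
proof -
  have "finite {i. x \<in> E i - E (Suc i)}"
  proof (cases "\<exists>i. x \<in> E i - E (Suc i)")
    case True
    then obtain i where "x \<in> E i - E (Suc i)" ..
    then have "{i. x \<in> E i - E (Suc i)} \<subseteq> {i}" using ring_unique by blast
    then show ?thesis by (rule finite_subset) simp
  next
    case False
    then have "{i. x \<in> E i - E (Suc i)} = {}" by blast
    then show ?thesis by (simp only: finite.emptyI)
  qed
  then have "summable (\<lambda>i. c i * indicator (E i - E (Suc i)) x)"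
    by (intro summable_finite[of "{i. x \<in> E i - E (Suc i)}"]) auto
  then show ?thesis unfolding step_fun_def by (rule summable_sums)
qed

lemma step_fun_on_ring:
  assumes "x \<in> E i - E (Suc i)" shows "step_fun c x = c i"
proof -
  have "step_fun c x = (\<Sum>j\<in>{i}. c j * indicator (E j - E (Suc j)) x)"
    unfolding step_fun_def using ring_unique[OF assms] by (intro suminf_finite) (auto simp: indicator_def)
  also have "\<dots> = c i" using assms by (subst sum.insert) auto
  finally show ?thesis .
qed

lemma step_fun_off_rings: "(\<And>i. x \<notin> E i - E (Suc i)) \<Longrightarrow> step_fun c x = 0"
  unfolding step_fun_def by (simp only: indicator_simps mult_zero_right suminf_zero not_False_eq_True)

lemma step_fun_measurable [measurable]: "step_fun c \<in> borel_measurable M"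
  unfolding step_fun_def by measurable

lemma step_fun_nonneg: "(\<And>i. 0 \<le> c i) \<Longrightarrow> 0 \<le> step_fun c x"
  by (metis step_fun_on_ring step_fun_off_rings order_refl)

text \<open>The mass \<open>t i - t (Suc i)\<close> divided by the measure of the ring
  \<open>E i - E (Suc i)\<close>. For decreasing \<open>t\<close> with limit 0, the step function
  with these values has integral \<open>t i\<close> over \<open>E i\<close>.\<close>

definition slopes :: "(nat \<Rightarrow> real) \<Rightarrow> nat \<Rightarrow> real" where
  "slopes t i = (t i - t (Suc i)) / (\<beta> ^ i - \<beta> ^ Suc i)"

lemma power_gap: "0 < \<beta> ^ i - \<beta> ^ Suc i"
  using \<beta> by simp

lemma slopes_nonneg: "decseq t \<Longrightarrow> 0 \<le> slopes t i"
  using power_gap[of i] by (auto simp: slopes_def decseq_Suc_iff)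

text \<open>The slopes are chosen so that the integral over a piece of the \<open>k\<close>-th layer telescopes.\<close>

lemma step_fun_slopes_integral:
  assumes t: "decseq t" "t \<longlonglongrightarrow> 0"
    and J: "J \<in> sets M" "J \<subseteq> E k" "\<And>i. measure M (J \<inter> E (k + i)) = \<beta> ^ i * measure M J"
  shows "(\<integral>\<^sup>+x\<in>J. ennreal (step_fun (slopes t) x) \<partial>M) = ennreal (t k / \<beta> ^ k * measure M J)"
proof -
  let ?R = "\<lambda>i. E i - E (Suc i)" and ?c = "slopes t"
  note [measurable] = J(1)
  \<comment> \<open>The integral over the part of \<open>J\<close> in the i-th ring; rings of index
    below \<open>k\<close> miss \<open>J\<close>, and the others meet it in the proportion \<mu>(J)
    / \<beta>^k.\<close>
  define g where "g i = (if i < k then 0 else (t i - t (Suc i)) * (measure M J / \<beta> ^ k))" for i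
  have ring: "?c i * measure M (J \<inter> ?R i) = g i" for i
  proof (cases "i < k")
    case True
    then have "J \<inter> ?R i = {}" using J(2) E_mono[of "Suc i" k] by auto
    then show ?thesis using True by (simp add: g_def)
  next
    case False
    then obtain j where i: "i = k + j" by (metis le_iff_add not_less)
    have "measure M (J \<inter> ?R i) = measure M (J \<inter> E i - J \<inter> E (Suc i))"
      by (rule arg_cong[where f = "measure M"]) auto
    also have "\<dots> = measure M (J \<inter> E i) - measure M (J \<inter> E (Suc i))"
      using E_mono[of i "Suc i"] by (intro finite_measure_Diff) auto
    also have "\<dots> = (\<beta> ^ i - \<beta> ^ Suc i) * (measure M J / \<beta> ^ k)"
      using J(3)[of j] J(3)[of "Suc j"] \<beta> by (simp add: i power_add field_simps)
    finally have m: "measure M (J \<inter> ?R i) = (\<beta> ^ i - \<beta> ^ Suc i) * (measure M J / \<beta> ^ k)" .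
    have "a / b * (b * y) = a * y" if "0 < b" for a b y :: real using that by simp
    from this[OF power_gap] show ?thesis by (simp only: m slopes_def g_def False if_False)
  qed
  have "(\<integral>\<^sup>+x\<in>J. ennreal (step_fun ?c x) \<partial>M) = (\<integral>\<^sup>+x. (\<Sum>i. ennreal (?c i * indicator (J \<inter> ?R i) x)) \<partial>M)"
  proof (rule nn_integral_cong)
    fix x
    have "(\<lambda>i. ?c i * indicator (J \<inter> ?R i) x) sums (step_fun ?c x * indicator J x)"
      using sums_mult2[OF step_fun_sums[of ?c x], of "indicator J x"]
      by (simp add: indicator_inter_arith mult_ac)
    then have "(\<Sum>i. ennreal (?c i * indicator (J \<inter> ?R i) x)) = ennreal (step_fun ?c x * indicator J x)"
      using slopes_nonneg[OF t(1)] by (intro suminf_ennreal_eq) auto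
    then show "ennreal (step_fun ?c x) * indicator J x = (\<Sum>i. ennreal (?c i * indicator (J \<inter> ?R i) x))"
      by (auto simp: indicator_def)
  qed
  also have "\<dots> = (\<Sum>i. \<integral>\<^sup>+x. ennreal (?c i * indicator (J \<inter> ?R i) x) \<partial>M)"
    by (intro nn_integral_suminf) measurable
  also have "\<dots> = (\<Sum>i. ennreal (g i))"
  proof (rule suminf_cong)
    fix i
    have "(\<integral>\<^sup>+x. ennreal (?c i * indicator (J \<inter> ?R i) x) \<partial>M) = (\<integral>\<^sup>+x. ennreal (?c i) * indicator (J \<inter> ?R i) x \<partial>M)"
      by (intro nn_integral_cong) (auto simp: indicator_def)
    also have "\<dots> = ennreal (?c i) * emeasure M (J \<inter> ?R i)"
      by (intro nn_integral_cmult_indicator) measurable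
    also have "\<dots> = ennreal (g i)"
      using slopes_nonneg[OF t(1), of i] ring[of i] by (simp add: emeasure_eq_measure flip: ennreal_mult)
    finally show "(\<integral>\<^sup>+x. ennreal (?c i * indicator (J \<inter> ?R i) x) \<partial>M) = ennreal (g i)" .
  qed
  also have "\<dots> = ennreal (t k / \<beta> ^ k * measure M J)"
  proof (rule suminf_ennreal_eq)
    have "(\<lambda>i. t (i + k) - t (Suc (i + k))) sums (t (0 + k) - 0)"
      using telescope_sums'[OF LIMSEQ_ignore_initial_segment[OF t(2), of k]] by simp
    then have "(\<lambda>i. g (i + k)) sums (t k * (measure M J / \<beta> ^ k))"
      using sums_mult2[of _ "t k" "measure M J / \<beta> ^ k"] by (simp add: g_def)
    then show "g sums (t k / \<beta> ^ k * measure M J)"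
      by (subst (asm) sums_iff_shift) (simp add: g_def)
    show "0 \<le> g i" for i using \<beta> t(1) by (auto simp: g_def decseq_Suc_iff)
  qed
  finally show ?thesis .
qed

text \<open>The tree element around \<open>x\<close> supplied by \<open>E_cover\<close> has the same
  average as \<open>E k\<close>, namely \<open>t k / \<beta> ^ k\<close>.\<close>

lemma maximal_op_step_fun_ge:
  assumes t: "decseq t" "t \<longlonglongrightarrow> 0" and x: "x \<in> E k"
  shows "ennreal (t k / \<beta> ^ k) \<le> maximal_op M T (step_fun (slopes t)) x"
proof -
  obtain J where J: "J \<in> T" "x \<in> J" "J \<subseteq> E k" "\<And>i. measure M (J \<inter> E (k + i)) = \<beta> ^ i * measure M J"
    using E_cover[OF x] by blast
  have pos: "0 < measure M J" using T_pos[OF J(1)] by (simp add: emeasure_eq_measure)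
  have "t k \<ge> 0" using t by (rule decseq_ge)
  then have "ennreal (t k / \<beta> ^ k) = ennreal (t k / \<beta> ^ k * measure M J) / emeasure M J"
    using pos \<beta> by (simp add: emeasure_eq_measure divide_ennreal)
  also have "\<dots> = (\<integral>\<^sup>+y\<in>J. ennreal \<bar>step_fun (slopes t) y\<bar> \<partial>M) / emeasure M J"
    using step_fun_slopes_integral[OF t T_measurable[OF J(1)] J(3,4)] slopes_nonneg[OF t(1)]
    by (simp add: step_fun_nonneg)
  also have "\<dots> \<le> maximal_op M T (step_fun (slopes t)) x"
    unfolding maximal_op_def using J(1,2) by (intro SUP_upper) auto
  finally show ?thesis .
qed

text \<open>The pure power \<open>B * s powr (- 1 / p)\<close> has the same weak norm at every
  scale, so agreement with it on all deep rings already forces the norm up to \<open>B\<close>,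
  whatever happens on the first rings below the bound.\<close>

lemma weak_lorentz_norm_step_fun:
  fixes B p :: real
  assumes p: "0 < p" and B: "0 < B"
    and c: "\<And>i. 0 \<le> c i" "\<And>i. c i \<le> B * (\<beta> ^ i) powr (- 1 / p)"
    and K: "\<And>i. K \<le> i \<Longrightarrow> c i = B * (\<beta> ^ i) powr (- 1 / p)"
  shows "weak_lorentz_norm M p (\<lambda>x. ennreal \<bar>step_fun c x\<bar>) = ennreal B"
proof (rule antisym)
  have abs: "\<bar>step_fun c x\<bar> = step_fun c x" for x using c by (simp add: step_fun_nonneg)
  have level: "\<exists>i. x \<in> E i - E (Suc i) \<and> l < c i" if "0 < l" "l < step_fun c x" for x l
    using that step_fun_on_ring step_fun_off_rings by (metis not_less_iff_gr_or_eq)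
  show "weak_lorentz_norm M p (\<lambda>x. ennreal \<bar>step_fun c x\<bar>) \<le> ennreal B"
    unfolding weak_lorentz_norm_le_iff[OF step_fun_measurable B p]
  proof (intro allI impI)
    fix l :: real assume l: "0 < l"
    let ?A = "{x \<in> space M. l < \<bar>step_fun c x\<bar>}"
    show "measure M ?A \<le> (B / l) powr p"
    proof (cases "\<exists>i. l < c i")
      case False
      then have "?A = {}" using level[OF l] by (auto simp: abs)
      then show ?thesis by (metis measure_empty powr_ge_zero)
    next
      case True
      \<comment> \<open>The values \<open>c i\<close> need not increase, so the first index above
        \<open>l\<close> is taken; it encloses the superlevel set in \<open>E i\<close>.\<close>
      define i where "i = (LEAST i. l < c i)"
      have i: "l < c i" using True unfolding i_def by (rule LeastI_ex)
      have "?A \<subseteq> E i"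
      proof
        fix x assume "x \<in> ?A"
        then obtain j where "x \<in> E j" "l < c j" using level[OF l] by (auto simp: abs)
        moreover have "i \<le> j" unfolding i_def using \<open>l < c j\<close> by (rule Least_le)
        ultimately show "x \<in> E i" using E_mono by auto
      qed
      then have "measure M ?A \<le> \<beta> ^ i" unfolding E_measure[symmetric] by (intro finite_measure_mono) auto
      also have "\<dots> = ((\<beta> ^ i) powr (1 / p)) powr p" using p \<beta> by (simp add: powr_powr)
      also have "\<dots> \<le> (B / l) powr p"
      proof (rule powr_mono2)
        have "l \<le> B * (\<beta> ^ i) powr (- 1 / p)" using c(2)[of i] i by simp
        then show "(\<beta> ^ i) powr (1 / p) \<le> B / l" using l \<beta> by (simp add: powr_minus_divide field_simps)
      qed (use p in auto)
      finally show ?thesis .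
    qed
  qed
  show "ennreal B \<le> weak_lorentz_norm M p (\<lambda>x. ennreal \<bar>step_fun c x\<bar>)"
  proof (rule ccontr)
    assume "\<not> ?thesis"
    then have less: "weak_lorentz_norm M p (\<lambda>x. ennreal \<bar>step_fun c x\<bar>) < ennreal B" by simp
    then obtain B1 where B1: "weak_lorentz_norm M p (\<lambda>x. ennreal \<bar>step_fun c x\<bar>) = ennreal B1" "0 \<le> B1"
      by (cases "weak_lorentz_norm M p (\<lambda>x. ennreal \<bar>step_fun c x\<bar>)" rule: ennreal_cases) auto
    with less have "B1 < B" by (simp add: ennreal_less_iff)
    \<comment> \<open>\<open>B1\<close> may be 0, while the midpoint is a positive bound for the
      norm still below \<open>B\<close>. With \<open>B3\<close> strictly in between,
      \<open>l\<close> stays below all values \<open>c i\<close> for \<open>i \<ge> K\<close>, and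
      the tail bound at \<open>l\<close> for \<open>B2\<close> is smaller than the measure of
      \<open>E K\<close>.\<close>
    define B2 where "B2 = (B1 + B) / 2"
    have B2: "B1 \<le> B2" "B2 < B" "0 < B2" using \<open>B1 < B\<close> B1(2) by (auto simp: B2_def)
    obtain B3 where B3: "B2 < B3" "B3 < B" using dense B2(2) by blast
    let ?s = "\<beta> ^ K"
    define l where "l = B3 * ?s powr (- 1 / p)"
    have l: "0 < l" using B3 B2 \<beta> by (simp add: l_def)
    have "measure M {x\<in>space M. l < \<bar>step_fun c x\<bar>} \<le> (B2 / l) powr p"
      using weak_lorentz_norm_le_iff[OF step_fun_measurable \<open>0 < B2\<close> p, of c] B1 B2 l by (auto intro: ennreal_leI)
    moreover have "?s \<le> measure M {x\<in>space M. l < \<bar>step_fun c x\<bar>}"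
    proof -
      have null: "measure M (\<Inter>i. E i) = 0"
      proof -
        have "(\<lambda>i. measure M (E i)) \<longlonglongrightarrow> measure M (\<Inter>i. E i)"
          using E_decseq by (intro finite_Lim_measure_decseq) auto
        moreover have "(\<lambda>i. measure M (E i)) \<longlonglongrightarrow> 0"
          unfolding E_measure using \<beta> by (intro LIMSEQ_power_zero) auto
        ultimately show ?thesis by (rule LIMSEQ_unique)
      qed
      have "E K - (\<Inter>i. E i) \<subseteq> {x\<in>space M. l < \<bar>step_fun c x\<bar>}"
      proof
        fix x assume x: "x \<in> E K - (\<Inter>i. E i)"
        \<comment> \<open>The first layer that misses \<open>x\<close> comes after \<open>K\<close>,
          so \<open>x\<close> lies in a ring of index at least \<open>K\<close>.\<close>
        define j where "j = (LEAST j. x \<notin> E j)"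
        have j: "x \<notin> E j" unfolding j_def by (rule LeastI_ex) (use x in auto)
        then have "K < j" using x E_mono[of j K] by (meson DiffD1 linorder_not_less subsetD)
        then obtain i where i: "j = Suc i" "K \<le> i" by (cases j) auto
        have "x \<in> E i" using not_less_Least[of i "\<lambda>j. x \<notin> E j"] i by (auto simp: j_def)
        then have "step_fun c x = c i" using j i by (intro step_fun_on_ring) auto
        also have "\<dots> = B * (\<beta> ^ i) powr (- 1 / p)" using K i by simp
        also have "\<dots> \<ge> B * ?s powr (- 1 / p)"
          using B p \<beta> i by (intro mult_left_mono powr_mono2') (auto intro: power_decreasing)
        finally have "B * ?s powr (- 1 / p) \<le> step_fun c x" .
        moreover have "l < B * ?s powr (- 1 / p)" using B3 \<beta> by (simp add: l_def)
        ultimately show "x \<in> {x\<in>space M. l < \<bar>step_fun c x\<bar>}"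
          using x sets.sets_into_space[OF E_sets] by (auto simp: abs)
      qed
      then have "measure M (E K - (\<Inter>i. E i)) \<le> measure M {x\<in>space M. l < \<bar>step_fun c x\<bar>}"
        by (intro finite_measure_mono) auto
      moreover have "measure M (E K - (\<Inter>i. E i)) = ?s"
        using null by (subst finite_measure_Diff) (auto simp: E_measure)
      ultimately show ?thesis by simp
    qed
    moreover have "(B2 / l) powr p < ?s"
    proof -
      have "(B2 / l) powr p = (B2 / B3) powr p * ?s"
        using B2 B3 \<beta> p by (simp add: l_def powr_divide powr_mult powr_powr powr_minus_divide)
      also have "\<dots> < 1 * ?s"
      proof (rule mult_strict_right_mono)
        show "(B2 / B3) powr p < 1" using B2 B3 p powr_less_mono2[of p "B2 / B3" 1] by simp
      qed (use \<beta> in auto)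
      finally show ?thesis by simp
    qed
    ultimately show False by simp
  qed
qed

end

section \<open>The Bellman function as an integral\<close>

lemma ennreal_powr_ennreal: "0 \<le> x \<Longrightarrow> ennreal_powr (ennreal x) a = ennreal (x powr a)"
  by (simp add: ennreal_powr_def)

lemma ennreal_powr_mono: "0 \<le> a \<Longrightarrow> x \<le> y \<Longrightarrow> ennreal_powr x a \<le> ennreal_powr y a"
  by (cases x rule: ennreal_cases; cases y rule: ennreal_cases)
    (auto simp: ennreal_powr_def top_unique intro!: ennreal_leI powr_mono2)

lemma ennreal_powr_inverse: "0 < r \<Longrightarrow> ennreal_powr (ennreal_powr x (1 / r)) r = x"
  by (cases x rule: ennreal_cases) (auto simp: ennreal_powr_def powr_powr)

text \<open>The function \<open>max (H t) L\<close>: the common upper bound for the rearrangements,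
  approached by the extremizers.\<close>

definition profile :: "real \<Rightarrow> real \<Rightarrow> real \<Rightarrow> real \<Rightarrow> real \<Rightarrow> real" where
  "profile p F f L t = max L (min (f / t) (p / (p - 1) * F powr (1 / p) * t powr (- 1 / p)))"

section \<open>Upper bound for the rearrangement\<close>

context tree_space
begin

lemma admissible_mass_le:
  assumes \<phi>: "\<phi> \<in> bellman_admissible M p F f" and p: "1 < p" and F: "0 < F"
    and A: "A \<in> sets M" "0 < measure M A"
  shows "(\<integral>\<^sup>+x\<in>A. ennreal \<bar>\<phi> x\<bar> \<partial>M) \<le> ennreal f"
    and "(\<integral>\<^sup>+x\<in>A. ennreal \<bar>\<phi> x\<bar> \<partial>M) \<le>
      ennreal (p / (p - 1) * F powr (1 / p) * measure M A powr (1 - 1 / p))"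
proof -
  have [measurable]: "\<phi> \<in> borel_measurable M" and int: "integrable M \<phi>" and f: "(\<integral>x. \<bar>\<phi> x\<bar> \<partial>M) = f"
    and W: "ennreal_powr (weak_lorentz_norm M p (\<lambda>x. ennreal \<bar>\<phi> x\<bar>)) p = ennreal F"
    using \<phi> by (auto simp: bellman_admissible_def)
  have "(\<integral>\<^sup>+x\<in>A. ennreal \<bar>\<phi> x\<bar> \<partial>M) \<le> (\<integral>\<^sup>+x. ennreal \<bar>\<phi> x\<bar> \<partial>M)"
    by (intro nn_integral_mono) (auto simp: indicator_def)
  also have "\<dots> = ennreal f"
    using int f by (subst nn_integral_eq_integral) auto
  finally show "(\<integral>\<^sup>+x\<in>A. ennreal \<bar>\<phi> x\<bar> \<partial>M) \<le> ennreal f" .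
  have "weak_lorentz_norm M p (\<lambda>x. ennreal \<bar>\<phi> x\<bar>) = ennreal_powr (ennreal F) (1 / p)"
    unfolding W[symmetric] using p ennreal_powr_inverse[of "1 / p"] by simp
  then have "weak_lorentz_norm M p (\<lambda>x. ennreal \<bar>\<phi> x\<bar>) \<le> ennreal (F powr (1 / p))"
    using F by (simp add: ennreal_powr_ennreal)
  then have "\<forall>l>0. measure M {x\<in>space M. l < \<bar>\<phi> x\<bar>} \<le> (F powr (1 / p) / l) powr p"
    using F p by (subst (asm) weak_lorentz_norm_le_iff) auto
  then show "(\<integral>\<^sup>+x\<in>A. ennreal \<bar>\<phi> x\<bar> \<partial>M) \<le>
      ennreal (p / (p - 1) * F powr (1 / p) * measure M A powr (1 - 1 / p))"
    using A p F by (intro nn_integral_weak_tail_le) auto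
qed

text \<open>For the superlevel set of measure m at height s, the weak type inequality bounds s m by
  f and by p' F^(1/p) m^(1-1/p). With s the profile value at t, one of the two forces m \<le>
  t.\<close>

lemma rearrangement_maximal_op_le:
  assumes \<phi>: "\<phi> \<in> bellman_admissible M p F f" and p: "1 < p" and F: "0 < F" and f: "0 < f" and L: "0 < L"
    and t: "0 < t"
  shows "rearrangement M (\<lambda>x. max (maximal_op M T \<phi> x) (ennreal L)) t \<le> ennreal (profile p F f L t)"
proof (rule rearrangement_le)
  define s where "s = profile p F f L t"
  let ?c = "p / (p - 1) * F powr (1 / p)"
  define E where "E = {x\<in>space M. ennreal s < maximal_op M T \<phi> x}"
  have s: "L \<le> s" by (simp add: s_def profile_def)
  have E_sets [measurable]: "E \<in> sets M" unfolding E_def by measurable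
  have [measurable]: "\<phi> \<in> borel_measurable M" using \<phi> by (simp add: bellman_admissible_def)
  \<comment> \<open>Since \<open>s\<close> is at least \<open>L\<close>, the constant cannot exceed
    it and only the maximal operator counts.\<close>
  have "{x\<in>space M. ennreal s < max (maximal_op M T \<phi> x) (ennreal L)} = E"
    using s L by (auto simp: E_def less_max_iff_disj ennreal_less_iff)
  moreover have "measure M E \<le> t"
  proof (cases "measure M E = 0")
    case False
    define m where "m = measure M E"
    have m: "0 < m" using False by (simp add: m_def zero_less_measure_iff)
    have weak: "ennreal (s * m) \<le> (\<integral>\<^sup>+x\<in>E. ennreal \<bar>\<phi> x\<bar> \<partial>M)"
      using maximal_op_weak_type[of \<phi> "ennreal s"] s L
      by (simp add: E_def[symmetric] emeasure_eq_measure m_def ennreal_mult)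
    have 1: "s * m \<le> f"
      using order_trans[OF weak admissible_mass_le(1)[OF \<phi> p F E_sets]] m f by (simp add: m_def)
    have 2: "s * m \<le> ?c * m powr (1 - 1 / p)"
    proof -
      have "0 \<le> ?c * m powr (1 - 1 / p)" using p F by simp
      then show ?thesis
        using order_trans[OF weak admissible_mass_le(2)[OF \<phi> p F E_sets]] m
        by (simp add: m_def)
    qed
    \<comment> \<open>\<open>s\<close> dominates the smaller branch at \<open>t\<close>; that branch
      is compared with the mass bound of the same kind.\<close>
    consider "f / t \<le> s" | "?c * t powr (- 1 / p) \<le> s"
      unfolding s_def profile_def by (metis max.cobounded2 min_def)
    then show ?thesis
    proof cases
      case 1
      then have "f / t * m \<le> f" using \<open>s * m \<le> f\<close> m by (meson less_imp_le mult_right_mono order_trans)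
      then show ?thesis using f t by (simp add: m_def field_simps)
    next
      case 2
      then have "?c * t powr (- 1 / p) * m \<le> ?c * m powr (1 - 1 / p)"
        using \<open>s * m \<le> ?c * m powr (1 - 1 / p)\<close> m by (meson less_imp_le mult_right_mono order_trans)
      then have "?c * (t powr (- 1 / p) * m) \<le> ?c * m powr (1 - 1 / p)" by (simp only: mult.assoc)
      moreover have "0 < ?c" using p F by simp
      ultimately have "t powr (- 1 / p) * m \<le> m powr (1 - 1 / p)" by (simp only: mult_le_cancel_left_pos)
      then have "m powr (1 / p) \<le> t powr (1 / p)"
        using t m by (simp add: powr_minus_divide powr_diff field_simps)
      then show ?thesis using powr_less_mono2[of "1 / p" t m] t p by (force simp: m_def not_less[symmetric])
    qed
  qed (use t in simp)
  ultimately show "emeasure M {x\<in>space M. ennreal (profile p F f L t) < max (maximal_op M T \<phi> x) (ennreal L)} \<le> ennreal t"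
    by (simp add: s_def emeasure_eq_measure ennreal_leI)
qed

end

text \<open>The quotient is the inverse of the difference quotient of x^(1-1/p) at 1, so it tends to
  p' as \<beta> tends to 1 from the left. The bound with \<open>c\<close> will make the truncation
  at \<open>f\<close> active; those with \<delta> limit the loss from discretizing.\<close>

lemma ladder_ratio_exists:
  fixes p \<delta> c :: real
  assumes p: "1 < p" and \<delta>: "\<delta> < 1" and c: "c < p / (p - 1)"
  shows "\<exists>\<beta>. 0 < \<beta> \<and> \<beta> < 1 \<and> \<delta> \<le> \<beta> \<and>
    c < (1 - \<beta>) / (1 - \<beta> powr (1 - 1 / p)) \<and>
    \<delta> * (p / (p - 1)) \<le> (1 - \<beta>) / (1 - \<beta> powr (1 - 1 / p)) * \<beta> powr (1 / p)"
proof -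
  let ?\<kappa> = "\<lambda>\<beta>. (1 - \<beta>) / (1 - \<beta> powr (1 - 1 / p))"
  have "((\<lambda>x. x powr (1 - 1 / p)) has_real_derivative (1 - 1 / p)) (at 1)"
    by (auto intro!: derivative_eq_intros)
  then have "((\<lambda>x. (x powr (1 - 1 / p) - 1) / (x - 1)) \<longlongrightarrow> 1 - 1 / p) (at_left 1)"
    by (auto simp: has_field_derivative_iff intro: tendsto_mono[OF at_le])
  then have "((\<lambda>x. inverse ((x powr (1 - 1 / p) - 1) / (x - 1))) \<longlongrightarrow> inverse (1 - 1 / p)) (at_left 1)"
    using p by (intro tendsto_inverse) auto
  moreover have "inverse (1 - 1 / p) = p / (p - 1)" using p by (simp add: field_simps)
  moreover have "inverse ((x powr (1 - 1 / p) - 1) / (x - 1)) = ?\<kappa> x" for x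
    using minus_divide_divide[of "x - 1" "x powr (1 - 1 / p) - 1"] by simp
  ultimately have lim: "(?\<kappa> \<longlongrightarrow> p / (p - 1)) (at_left 1)" by simp
  have "((\<lambda>x. x powr (1 / p)) \<longlongrightarrow> 1 powr (1 / p)) (at_left (1::real))"
    by (intro tendsto_intros) auto
  from tendsto_mult[OF lim this]
  have lim2: "((\<lambda>x. ?\<kappa> x * x powr (1 / p)) \<longlongrightarrow> p / (p - 1)) (at_left 1)" by simp
  have "\<delta> * (p / (p - 1)) < p / (p - 1)"
    using mult_strict_right_mono[OF \<delta>, of "p / (p - 1)"] p by simp
  then have "\<forall>\<^sub>F x in at_left 1. \<delta> * (p / (p - 1)) < ?\<kappa> x * x powr (1 / p)"
    by (rule order_tendstoD(1)[OF lim2])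
  moreover have "\<forall>\<^sub>F x in at_left 1. c < ?\<kappa> x" by (rule order_tendstoD(1)[OF lim c])
  moreover have "\<forall>\<^sub>F x::real in at_left 1. max 0 \<delta> < x"
    using \<delta> by (intro order_tendstoD(1)[OF tendsto_ident_at]) auto
  moreover have "\<forall>\<^sub>F x::real in at_left 1. x < 1" by (auto simp: eventually_at_filter)
  ultimately have "\<forall>\<^sub>F x in at_left 1. \<delta> * (p / (p - 1)) < ?\<kappa> x * x powr (1 / p) \<and> c < ?\<kappa> x \<and> max 0 \<delta> < x \<and> x < 1"
    by eventually_elim auto
  from eventually_happens[OF this] show ?thesis by (auto intro: less_imp_le)
qed

section \<open>The discretized extremizer\<close>

context tree_ladder
begin

text \<open>
  The intended integral of the extremizer over \<open>E k\<close>: truncating the geometric sequence of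
  tail masses of the discretized power function at \<open>f\<close>.
\<close>

definition mass :: "real \<Rightarrow> real \<Rightarrow> real \<Rightarrow> nat \<Rightarrow> real" where
  "mass p F f k = min f (F powr (1 / p) * ((1 - \<beta>) / (1 - \<beta> powr (1 - 1 / p))) * (\<beta> ^ k) powr (1 - 1 / p))"

text \<open>Without truncation, consecutive masses differ by exactly F^(1/p) (\<beta>^i)^(-1/p)
  times the measure of the ring. Truncating at \<open>f\<close> can only shrink the differences, and
  since the geometric masses tend to 0 it has no effect from some index on.\<close>

lemma
  assumes p: "1 < p" and F: "0 < F" and f: "0 < f"
  shows mass_decseq: "decseq (mass p F f)" and mass_tendsto: "mass p F f \<longlonglongrightarrow> 0"
    and slopes_mass_le: "slopes (mass p F f) i \<le> F powr (1 / p) * (\<beta> ^ i) powr (- 1 / p)"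
    and slopes_mass_eq: "\<exists>K. \<forall>i\<ge>K. slopes (mass p F f) i = F powr (1 / p) * (\<beta> ^ i) powr (- 1 / p)"
proof -
  define \<rho> where "\<rho> = \<beta> powr (1 - 1 / p)"
  have \<rho>: "0 < \<rho>" "\<rho> < 1" using \<beta> p powr_less_mono2[of "1 - 1 / p" \<beta> 1] by (auto simp: \<rho>_def)
  define a where "a = F powr (1 / p) * ((1 - \<beta>) / (1 - \<rho>))"
  have a: "0 < a" using F \<rho> \<beta> by (simp add: a_def)
  have pw: "(\<beta> ^ k) powr (1 - 1 / p) = \<rho> ^ k" for k
    using \<beta> by (simp add: \<rho>_def powr_powr mult.commute flip: powr_realpow)
  have mass: "mass p F f k = min f (a * \<rho> ^ k)" for k
    unfolding mass_def pw by (simp add: a_def \<rho>_def)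
  have dec: "a * \<rho> ^ Suc k \<le> a * \<rho> ^ k" for k using a \<rho> by simp
  show "decseq (mass p F f)" unfolding decseq_Suc_iff mass by (intro allI min.mono order_refl dec)
  have lim: "(\<lambda>k. a * \<rho> ^ k) \<longlonglongrightarrow> 0"
    using \<rho> by (intro tendsto_mult_right_zero LIMSEQ_power_zero) auto
  from tendsto_min[OF tendsto_const[of f] this] show "mass p F f \<longlonglongrightarrow> 0"
    unfolding mass using f by simp
  have ring: "a * \<rho> ^ i - a * \<rho> ^ Suc i = F powr (1 / p) * (\<beta> ^ i) powr (- 1 / p) * (\<beta> ^ i - \<beta> ^ Suc i)" for i
  proof -
    have 1: "a * (1 - \<rho>) = F powr (1 / p) * (1 - \<beta>)" using \<rho> by (simp add: a_def)
    have 2: "\<rho> ^ i = (\<beta> ^ i) powr (- 1 / p) * \<beta> ^ i"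
      unfolding pw[symmetric] using \<beta> by (simp add: powr_diff powr_minus_divide)
    have "a * \<rho> ^ i - a * \<rho> ^ Suc i = a * (1 - \<rho>) * \<rho> ^ i" by (simp add: algebra_simps)
    also have "\<dots> = F powr (1 / p) * (1 - \<beta>) * ((\<beta> ^ i) powr (- 1 / p) * \<beta> ^ i)" unfolding 1 2 ..
    also have "\<dots> = F powr (1 / p) * (\<beta> ^ i) powr (- 1 / p) * (\<beta> ^ i - \<beta> ^ Suc i)"
      by (simp add: algebra_simps)
    finally show ?thesis .
  qed
  have "mass p F f i - mass p F f (Suc i) \<le> a * \<rho> ^ i - a * \<rho> ^ Suc i"
    unfolding mass using dec[of i] by (auto simp: min_def)
  then show "slopes (mass p F f) i \<le> F powr (1 / p) * (\<beta> ^ i) powr (- 1 / p)"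
    unfolding slopes_def ring using power_gap[of i] by (simp only: pos_divide_le_eq)
  obtain K where K: "\<And>i. i \<ge> K \<Longrightarrow> a * \<rho> ^ i < f"
    using order_tendstoD(2)[OF lim f] by (auto simp: eventually_sequentially)
  have "slopes (mass p F f) i = F powr (1 / p) * (\<beta> ^ i) powr (- 1 / p)" if "K \<le> i" for i
  proof -
    have m: "mass p F f i = a * \<rho> ^ i" "mass p F f (Suc i) = a * \<rho> ^ Suc i"
      unfolding mass using K[of i] K[of "Suc i"] that by auto
    have "0 < b \<Longrightarrow> x * b / b = x" for x b :: real by simp
    from this[OF power_gap] show ?thesis unfolding slopes_def m ring .
  qed
  then show "\<exists>K. \<forall>i\<ge>K. slopes (mass p F f) i = F powr (1 / p) * (\<beta> ^ i) powr (- 1 / p)" by blast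
qed

text \<open>The assumption \<open>less\<close> makes the truncation active at \<open>k = 0\<close>,
  so the total mass is exactly \<open>f\<close>; the deep rings, where it is inactive, fix the weak
  norm at F^(1/p).\<close>

lemma extremizer_admissible:
  assumes p: "1 < p" and F: "0 < F" and f: "0 < f"
    and less: "f < F powr (1 / p) * ((1 - \<beta>) / (1 - \<beta> powr (1 - 1 / p)))"
  shows "step_fun (slopes (mass p F f)) \<in> bellman_admissible M p F f"
proof -
  let ?m = "mass p F f" and ?\<phi> = "step_fun (slopes (mass p F f))"
  note dec = mass_decseq[OF p F f] and lim = mass_tendsto[OF p F f]
  have nn: "0 \<le> ?\<phi> x" for x using slopes_nonneg[OF dec] by (rule step_fun_nonneg)
  have "?m 0 = f" using less by (simp add: mass_def)
  then have int: "(\<integral>\<^sup>+x\<in>space M. ennreal (?\<phi> x) \<partial>M) = ennreal f"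
    using step_fun_slopes_integral[OF dec lim, of "space M" 0] E_0 E_measure sets.sets_into_space[OF E_sets]
    by (simp add: prob_space Int_absorb1)
  then have "(\<integral>\<^sup>+x. ennreal (?\<phi> x) \<partial>M) = ennreal f"
    by (simp add: nn_integral_set_ennreal[symmetric] cong: nn_integral_cong)
  then have hbi: "has_bochner_integral M ?\<phi> f"
    using f nn by (intro has_bochner_integral_nn_integral) auto
  obtain K where K: "\<And>i. K \<le> i \<Longrightarrow> slopes ?m i = F powr (1 / p) * (\<beta> ^ i) powr (- 1 / p)"
    using slopes_mass_eq[OF p F f] by blast
  have "weak_lorentz_norm M p (\<lambda>x. ennreal \<bar>?\<phi> x\<bar>) = ennreal (F powr (1 / p))"
    using p F slopes_nonneg[OF dec] slopes_mass_le[OF p F f] K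
    by (intro weak_lorentz_norm_step_fun) auto
  then have "ennreal_powr (weak_lorentz_norm M p (\<lambda>x. ennreal \<bar>?\<phi> x\<bar>)) p = ennreal F"
    using F p by (simp add: ennreal_powr_ennreal powr_powr)
  with hbi nn show ?thesis
    by (auto simp: bellman_admissible_def has_bochner_integral_iff)
qed

text \<open>The maximal operator is at least \<open>mass p F f k / \<beta> ^ k\<close> on
  \<open>E k\<close>. Choosing \<open>k\<close> with \<beta>^(k+1) \<le> t < \<beta>^k, the factor
  \<delta> absorbs the error of replacing t by \<beta>^k in each branch of the profile.\<close>

lemma rearrangement_extremizer_ge:
  assumes p: "1 < p" and F: "0 < F" and f: "0 < f" and L: "0 < L"
    and \<delta>: "0 < \<delta>" "\<delta> \<le> \<beta>" "\<delta> * (p / (p - 1)) \<le> (1 - \<beta>) / (1 - \<beta> powr (1 - 1 / p)) * \<beta> powr (1 / p)"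
    and t: "0 < t" "t < 1"
  shows "ennreal (\<delta> * profile p F f L t) \<le>
    rearrangement M (\<lambda>x. max (maximal_op M T (step_fun (slopes (mass p F f))) x) (ennreal L)) t"
proof -
  let ?m = "mass p F f" and ?\<phi> = "step_fun (slopes (mass p F f))"
  let ?\<kappa> = "(1 - \<beta>) / (1 - \<beta> powr (1 - 1 / p))"
  let ?\<psi> = "\<lambda>x. max (maximal_op M T ?\<phi> x) (ennreal L)"
  note dec = mass_decseq[OF p F f] and lim = mass_tendsto[OF p F f]
  \<comment> \<open>Since \<beta>^0 = 1 > t, the least exponent is positive and has a predecessor
    \<open>k\<close>; then \<open>E k\<close> has measure above \<open>t\<close>.\<close>
  define n where "n = (LEAST n. \<beta> ^ n \<le> t)"
  have "\<exists>n. \<beta> ^ n \<le> t" using real_arch_pow_inv[OF t(1) \<beta>(2)] by (auto intro: less_imp_le)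
  then have n: "\<beta> ^ n \<le> t" unfolding n_def by (rule LeastI_ex)
  then have "n \<noteq> 0" using t by (cases n) auto
  then obtain k where k: "n = Suc k" by (cases n) auto
  have tk: "t < \<beta> ^ k" using not_less_Least[of k "\<lambda>n. \<beta> ^ n \<le> t"] k by (simp add: n_def)
  have bk: "0 < \<beta> ^ k" using \<beta> by simp
  have "\<delta> * profile p F f L t \<le> max L (?m k / \<beta> ^ k)"
  proof -
    have 1: "\<delta> * L \<le> L" using \<delta>(1,2) \<beta> L by simp
    have 2: "\<delta> * (f / t) \<le> f / \<beta> ^ k"
    proof -
      have "\<delta> * \<beta> ^ k \<le> \<beta> * \<beta> ^ k" using \<delta>(2) bk by (intro mult_right_mono) auto
      also have "\<dots> \<le> t" using n k by simp
      finally have "f * (\<delta> * \<beta> ^ k) \<le> f * t" using f by (intro mult_left_mono) auto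
      then show ?thesis using t bk by (simp add: field_simps)
    qed
    have 3: "\<delta> * (p / (p - 1) * F powr (1 / p) * t powr (- 1 / p)) \<le> F powr (1 / p) * ?\<kappa> * (\<beta> ^ k) powr (1 - 1 / p) / \<beta> ^ k"
    proof -
      have \<kappa>: "0 \<le> ?\<kappa>" using \<beta> p powr_less_mono2[of "1 - 1 / p" \<beta> 1] by simp
      have "\<delta> * (p / (p - 1) * F powr (1 / p) * t powr (- 1 / p)) = \<delta> * (p / (p - 1)) * (F powr (1 / p) * t powr (- 1 / p))"
        by simp
      also have "\<dots> \<le> ?\<kappa> * \<beta> powr (1 / p) * (F powr (1 / p) * t powr (- 1 / p))"
        using \<delta>(3) by (intro mult_right_mono) auto
      \<comment> \<open>The factor \<open>\<beta> powr (1 / p)\<close> pays for returning from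
        \<beta>^(k+1) to \<beta>^k.\<close>
      also have "\<dots> \<le> ?\<kappa> * \<beta> powr (1 / p) * (F powr (1 / p) * (\<beta> * \<beta> ^ k) powr (- 1 / p))"
      proof (intro mult_left_mono)
        show "t powr (- 1 / p) \<le> (\<beta> * \<beta> ^ k) powr (- 1 / p)"
          using n k \<beta> p by (intro powr_mono2') auto
        show "0 \<le> ?\<kappa> * \<beta> powr (1 / p)" by (rule mult_nonneg_nonneg[OF \<kappa> powr_ge_zero])
      qed simp
      also have "\<dots> = F powr (1 / p) * ?\<kappa> * (\<beta> powr (1 / p) * (\<beta> * \<beta> ^ k) powr (- 1 / p))" by (simp only: mult_ac)
      also have "\<beta> powr (1 / p) * (\<beta> * \<beta> ^ k) powr (- 1 / p) = (\<beta> ^ k) powr (- 1 / p)"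
        using \<beta> by (simp add: powr_mult powr_minus_divide)
      also have "\<dots> = (\<beta> ^ k) powr (1 - 1 / p) / \<beta> ^ k"
        using \<beta> by (simp add: powr_diff powr_minus_divide)
      finally show ?thesis by simp
    qed
    have "\<delta> * min x y = min (\<delta> * x) (\<delta> * y)" "\<delta> * max x y = max (\<delta> * x) (\<delta> * y)" for x y
      using \<delta>(1) by (auto simp: min_def max_def)
    moreover have "?m k / \<beta> ^ k = min (f / \<beta> ^ k) (F powr (1 / p) * ?\<kappa> * (\<beta> ^ k) powr (1 - 1 / p) / \<beta> ^ k)"
      unfolding mass_def using bk by (simp only: min_divide_distrib_right less_imp_le if_True)
    ultimately show ?thesis
      unfolding profile_def using 1 2 3 by (simp only: max.mono min.mono)
  qed
  then have "ennreal (\<delta> * profile p F f L t) \<le> ennreal (max L (?m k / \<beta> ^ k))" by (rule ennreal_leI)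
  also have "\<dots> \<le> rearrangement M ?\<psi> t"
  proof (rule le_rearrangement)
    fix s assume s: "s < ennreal (max L (?m k / \<beta> ^ k))"
    have [measurable]: "{x\<in>space M. s < ?\<psi> x} \<in> sets M" by measurable
    have "max L (?m k / \<beta> ^ k) = L \<or> max L (?m k / \<beta> ^ k) = ?m k / \<beta> ^ k" by (simp add: max_def)
    with s consider "s < ennreal L" | "s < ennreal (?m k / \<beta> ^ k)" by force
    then have "E k \<subseteq> {x\<in>space M. s < ?\<psi> x}"
    proof cases
      case 1
      then show ?thesis using sets.sets_into_space[OF E_sets] by (auto simp: less_max_iff_disj)
    next
      case 2
      then show ?thesis
        using sets.sets_into_space[OF E_sets] maximal_op_step_fun_ge[OF dec lim, of _ k]
        by (auto simp: less_max_iff_disj intro: less_le_trans)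
    qed
    then have "emeasure M (E k) \<le> emeasure M {x\<in>space M. s < ?\<psi> x}" by (intro emeasure_mono) auto
    moreover have "ennreal t < emeasure M (E k)"
      using tk t by (simp add: emeasure_eq_measure E_measure ennreal_less_iff)
    ultimately show "ennreal t < emeasure M {x\<in>space M. s < ?\<psi> x}" by (rule less_le_trans[rotated])
  qed
  finally show ?thesis .
qed

end

section \<open>The two bounds combined\<close>

lemma ennreal_powr_lorentz_norm:
  "0 < r \<Longrightarrow> ennreal_powr (lorentz_norm M q r \<psi>) r =
    (\<integral>\<^sup>+t\<in>{0<..1}. ennreal (t powr (r / q - 1)) * ennreal_powr (rearrangement M \<psi> t) r \<partial>lborel)"
  unfolding lorentz_norm_def by (rule ennreal_powr_inverse)

text \<open>The upper bound holds pointwise in t under the integral. The lower bound holds up to a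
  factor \<eta> < 1, with a ladder depending on \<eta>, and then \<eta> tends to 1.\<close>

lemma (in tree_space) bellman_eq_profile_integral:
  assumes p: "1 < p" and r: "0 < r" and F: "0 < F" and f: "0 < f" and L: "0 < L"
    and less: "f < p / (p - 1) * F powr (1 / p)"
  shows "bellman M T p q r F f L =
    (\<integral>\<^sup>+t\<in>{0<..1}. ennreal (t powr (r / q - 1) * profile p F f L t powr r) \<partial>lborel)" (is "_ = ?V")
proof (rule antisym)
  have pos: "0 < profile p F f L t" for t using L by (simp add: profile_def less_max_iff_disj)
  show "bellman M T p q r F f L \<le> ?V"
    unfolding bellman_def ennreal_powr_lorentz_norm[OF r]
  proof (intro SUP_least nn_integral_mono)
    fix \<phi> and t :: real assume \<phi>: "\<phi> \<in> bellman_admissible M p F f"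
    let ?R = "rearrangement M (\<lambda>x. max (maximal_op M T \<phi> x) (ennreal L))"
    show "ennreal (t powr (r / q - 1)) * ennreal_powr (?R t) r * indicator {0<..1} t
      \<le> ennreal (t powr (r / q - 1) * profile p F f L t powr r) * indicator {0<..1} t"
    proof (cases "t \<in> {0<..1}")
      case True
      then have "ennreal_powr (?R t) r \<le> ennreal_powr (ennreal (profile p F f L t)) r"
        using rearrangement_maximal_op_le[OF \<phi> p F f L] r by (intro ennreal_powr_mono) auto
      then show ?thesis using True pos[of t]
        by (simp add: ennreal_powr_ennreal ennreal_mult mult_left_mono)
    qed simp
  qed
  have "ennreal \<eta> * ?V \<le> bellman M T p q r F f L" if \<eta>: "0 < \<eta>" "\<eta> < 1" for \<eta>
  proof -
    \<comment> \<open>The profile enters with the power r, so a factor \<delta> on it becomes \<eta>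
      in the integral.\<close>
    define \<delta> where "\<delta> = \<eta> powr (1 / r)"
    have \<delta>: "0 < \<delta>" "\<delta> < 1" "\<delta> powr r = \<eta>"
      using \<eta> r powr_less_mono2[of "1 / r" \<eta> 1] by (auto simp: \<delta>_def powr_powr)
    have "f / F powr (1 / p) < p / (p - 1)" using less F by (simp add: field_simps)
    from ladder_ratio_exists[OF p \<delta>(2) this] obtain \<beta> where ratio: "0 < \<beta>" "\<beta> < 1" "\<delta> \<le> \<beta>"
      "f / F powr (1 / p) < (1 - \<beta>) / (1 - \<beta> powr (1 - 1 / p))"
      "\<delta> * (p / (p - 1)) \<le> (1 - \<beta>) / (1 - \<beta> powr (1 - 1 / p)) * \<beta> powr (1 / p)" by blast
    obtain E where "tree_ladder M T C \<beta> E" using ladder_exists[OF ratio(1,2)] by blast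
    then interpret tree_ladder M T C \<beta> E .
    define \<phi> where "\<phi> = step_fun (slopes (mass p F f))"
    let ?R = "rearrangement M (\<lambda>x. max (maximal_op M T \<phi> x) (ennreal L))"
    have adm: "\<phi> \<in> bellman_admissible M p F f"
      unfolding \<phi>_def using ratio(4) F by (intro extremizer_admissible p F f) (simp add: field_simps)
    have "ennreal \<eta> * ?V = (\<integral>\<^sup>+t. ennreal \<eta> * (ennreal (t powr (r / q - 1) * profile p F f L t powr r) * indicator {0<..1} t) \<partial>lborel)"
      unfolding profile_def by (intro nn_integral_cmult[symmetric]) measurable
    also have "\<dots> \<le> (\<integral>\<^sup>+t\<in>{0<..1}. ennreal (t powr (r / q - 1)) * ennreal_powr (?R t) r \<partial>lborel)"
    proof (rule nn_integral_mono_AE)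
      \<comment> \<open>The right-continuous rearrangement vanishes at t = 1, where the lower bound
        therefore fails; a single point does not affect the integral.\<close>
      have "AE t in lborel. t \<noteq> (1::real)" by (rule AE_lborel_singleton)
      then show "AE t in lborel. ennreal \<eta> * (ennreal (t powr (r / q - 1) * profile p F f L t powr r) * indicator {0<..1} t)
        \<le> ennreal (t powr (r / q - 1)) * ennreal_powr (?R t) r * indicator {0<..1} t"
      proof eventually_elim
        fix t :: real assume "t \<noteq> 1"
        show "ennreal \<eta> * (ennreal (t powr (r / q - 1) * profile p F f L t powr r) * indicator {0<..1} t)
          \<le> ennreal (t powr (r / q - 1)) * ennreal_powr (?R t) r * indicator {0<..1} t"
        proof (cases "t \<in> {0<..1}")
          case True
          with \<open>t \<noteq> 1\<close> have t: "0 < t" "t < 1" by auto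
          have "ennreal (\<eta> * profile p F f L t powr r) = ennreal_powr (ennreal (\<delta> * profile p F f L t)) r"
            using \<delta> pos[of t] by (simp add: ennreal_powr_ennreal powr_mult)
          also have "\<dots> \<le> ennreal_powr (?R t) r"
            using rearrangement_extremizer_ge[OF p F f L \<delta>(1) ratio(3,5) t] r
            by (intro ennreal_powr_mono) (auto simp: \<phi>_def)
          finally have "ennreal (t powr (r / q - 1)) * ennreal (\<eta> * profile p F f L t powr r) \<le>
              ennreal (t powr (r / q - 1)) * ennreal_powr (?R t) r"
            by (intro mult_left_mono) auto
          then show ?thesis using True \<eta> by (simp add: mult.left_commute flip: ennreal_mult)
        qed simp
      qed
    qed
    also have "\<dots> \<le> bellman M T p q r F f L"
      unfolding bellman_def ennreal_powr_lorentz_norm[OF r, symmetric] using adm by (rule SUP_upper)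
    finally show ?thesis .
  qed
  then have scaled: "\<And>\<eta>. 0 < \<eta> \<Longrightarrow> \<eta> < 1 \<Longrightarrow> ennreal \<eta> * ?V \<le> bellman M T p q r F f L" .
  show "?V \<le> bellman M T p q r F f L"
  proof (cases "bellman M T p q r F f L" rule: ennreal_cases)
    case b: (real b)
    \<comment> \<open>Finiteness follows from the scaled inequality itself, so the limit in \<eta>
      can be taken in the reals.\<close>
    have "?V \<noteq> \<infinity>"
    proof
      assume V: "?V = \<infinity>"
      have "ennreal (1 / 2) * \<infinity> \<le> ennreal b" using scaled[of "1 / 2"] unfolding V b by simp
      then show False by (simp add: ennreal_mult_top top_unique)
    qed
    then obtain v where v: "?V = ennreal v" "0 \<le> v" by (cases ?V rule: ennreal_cases) auto
    have "v \<le> b"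
    proof (rule field_le_mult_one_interval)
      fix \<eta> :: real assume \<eta>: "0 < \<eta>" "\<eta> < 1"
      then have "ennreal (\<eta> * v) \<le> ennreal b"
        using scaled[OF \<eta>] unfolding b v(1) by (simp add: ennreal_mult v(2))
      then show "\<eta> * v \<le> b" using b(1) by simp
    qed
    then show ?thesis using v b by (simp add: ennreal_leI)
  qed simp
qed

section \<open>Evaluation of the integral\<close>

lemma has_integral_powr_Icc:
  fixes a b e :: real
  assumes "0 < a" "a \<le> b" "e \<noteq> 0"
  shows "((\<lambda>t. t powr (e - 1)) has_integral (b powr e - a powr e) / e) {a..b}"
proof -
  have int: "((\<lambda>t. t powr (e - 1)) has_integral (b powr e / e - a powr e / e)) {a..b}"
    using assms by (intro fundamental_theorem_of_calculus)
      (auto intro!: derivative_eq_intros simp flip: has_real_derivative_iff_has_vector_derivative)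
  then show ?thesis by (simp add: diff_divide_distrib)
qed

text \<open>Identities between products of powers become linear in the logarithms of the
  bases.\<close>

lemma powr_eqI: "0 < x \<Longrightarrow> 0 < y \<Longrightarrow> ln x = ln y \<Longrightarrow> x = (y::real)"
  by simp

locale profile_params =
  fixes p q r F f L :: real
  assumes q: "1 < q" and qp: "q < p" and r: "0 < r" and F: "0 < F" and f: "0 < f"
    and less: "f < p / (p - 1) * F powr (1 / p)" and fL: "f \<le> L"
begin

lemma p_gt_1: "1 < p" using q qp by simp

lemma L_pos: "0 < L" using f fL by simp

text \<open>The coefficient of the power branch of the profile.\<close>

definition c :: real where "c = p / (p - 1) * F powr (1 / p)"

text \<open>The point at which the two branches of the minimum in the profile cross.\<close>

definition t0 :: real where "t0 = (f / c) powr (p / (p - 1))"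

definition integrand :: "real \<Rightarrow> real" where
  "integrand t = t powr (r / q - 1) * profile p F f L t powr r"

lemma c_pos: "0 < c" using p_gt_1 F by (simp add: c_def)

lemma ln_c: "ln c = ln (p / (p - 1)) + 1 / p * ln F"
  unfolding c_def using p_gt_1 F by (subst ln_mult) (auto simp: ln_powr)

lemma profile_eq: "profile p F f L t = max L (min (f / t) (c * t powr (- 1 / p)))"
  by (simp only: profile_def c_def)

lemma t0_bounds: "0 < t0" "t0 < 1"
proof -
  have "f < c" using less by (simp only: c_def)
  then show "0 < t0" "t0 < 1"
    using c_pos f p_gt_1 powr_less_mono2[of "p / (p - 1)" "f / c" 1] by (auto simp: t0_def)
qed

lemma ln_t0: "ln t0 = p / (p - 1) * (ln f - ln c)"
  using f c_pos by (simp add: t0_def ln_powr ln_div)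

lemma f_eq: "f = c * t0 powr (1 - 1 / p)"
proof -
  have "p / (p - 1) * (1 - 1 / p) = 1" using p_gt_1 by (simp add: field_simps)
  then show ?thesis using c_pos f by (simp only: t0_def powr_powr) simp
qed

lemma t0_eq: "f / t0 = c * t0 powr (- 1 / p)"
  using c_pos t0_bounds by (subst f_eq) (simp add: powr_diff powr_minus_divide)

text \<open>The threshold for \<open>L\<close> in the theorem is the height at which the two
  branches meet. The case distinction thus decides whether \<open>L\<close> cuts the profile on the
  hyperbola or on the power branch.\<close>

lemma crossover: "(p / (p - 1)) powr (p / (p - 1)) * (F / f) powr (1 / (p - 1)) = f / t0"
proof (rule powr_eqI)
  have "ln (f / t0) = ln f - p / (p - 1) * (ln f - (ln (p / (p - 1)) + 1 / p * ln F))"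
  proof -
    have "ln (f / t0) = ln f - ln t0" using f t0_bounds(1) by (simp add: ln_div)
    then show ?thesis by (simp only: ln_t0 ln_c)
  qed
  also have "\<dots> = p / (p - 1) * ln (p / (p - 1)) + 1 / (p - 1) * (ln F - ln f)"
    using p_gt_1 by (simp add: divide_simps) (simp add: algebra_simps)
  also have "\<dots> = ln ((p / (p - 1)) powr (p / (p - 1)) * (F / f) powr (1 / (p - 1)))"
    using p_gt_1 F f by (simp add: ln_mult ln_div ln_powr)
  finally show "ln ((p / (p - 1)) powr (p / (p - 1)) * (F / f) powr (1 / (p - 1))) = ln (f / t0)" ..
qed (use p_gt_1 F f t0_bounds in auto)

text \<open>Multiplied by t, the branches are f = c t0^(1-1/p) and c t^(1-1/p), and the latter
  increases with t.\<close>

lemma hyperbola_le: assumes "t0 \<le> t" shows "f / t \<le> c * t powr (- 1 / p)"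
proof -
  have t: "0 < t" using t0_bounds assms by simp
  have "f / t = c * t0 powr (1 - 1 / p) / t"
    by (simp only: f_eq[symmetric])
  also have "\<dots> \<le> c * t powr (1 - 1 / p) / t"
    using c_pos t t0_bounds assms p_gt_1 by (intro divide_right_mono mult_left_mono powr_mono2) auto
  also have "\<dots> = c * t powr (- 1 / p)" using t by (simp add: powr_diff powr_minus_divide field_simps)
  finally show ?thesis .
qed

lemma hyperbola_ge: assumes "0 < t" "t \<le> t0" shows "c * t powr (- 1 / p) \<le> f / t"
proof -
  have "c * t powr (- 1 / p) = c * t powr (1 - 1 / p) / t"
    using assms by (simp add: powr_diff powr_minus_divide field_simps)
  also have "\<dots> \<le> c * t0 powr (1 - 1 / p) / t"
    using c_pos assms p_gt_1 by (intro divide_right_mono mult_left_mono powr_mono2) auto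
  also have "\<dots> = f / t"
    by (simp only: f_eq[symmetric])
  finally show ?thesis .
qed

section \<open>Integrating the profile piece by piece\<close>

lemma nn_integral_eq:
  assumes "(integrand has_integral v) {0..1}"
  shows "(\<integral>\<^sup>+t\<in>{0<..1}. ennreal (t powr (r / q - 1) * profile p F f L t powr r) \<partial>lborel) = ennreal v"
    and "0 \<le> v"
proof -
  have nn: "0 \<le> integrand t" for t by (simp add: integrand_def)
  \<comment> \<open>The endpoint 0 may be added because \<open>0 powr _\<close> is 0.\<close>
  have "(\<integral>\<^sup>+t\<in>{0<..1}. ennreal (integrand t) \<partial>lborel) = (\<integral>\<^sup>+t. ennreal (indicator {0..1} t * integrand t) \<partial>lborel)"
    by (intro nn_integral_cong) (auto simp: indicator_def integrand_def)
  also have "\<dots> = ennreal v"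
    using nn_integral_has_integral_lebesgue[OF _ assms] nn by simp
  finally show "(\<integral>\<^sup>+t\<in>{0<..1}. ennreal (t powr (r / q - 1) * profile p F f L t powr r) \<partial>lborel) = ennreal v"
    by (simp only: integrand_def)
  show "0 \<le> v" using assms nn by (rule has_integral_nonneg)
qed

text \<open>Up to \<open>s\<close> the power branch is below the hyperbola and above
  \<open>L\<close>; q < p makes the exponent \<open>r / q - r / p\<close> positive and the integral
  finite at 0.\<close>

lemma has_integral_small:
  assumes "0 < s" "s \<le> t0" "L \<le> c * s powr (- 1 / p)"
  shows "(integrand has_integral c powr r * s powr (r / q - r / p) / (r / q - r / p)) {0..s}"
proof -
  have e: "0 < r / q - r / p" using q qp r by (simp add: field_simps)
  have int: "((\<lambda>t. c powr r * t powr (r / q - r / p - 1)) has_integral c powr r * (s powr (r / q - r / p) / (r / q - r / p))) {0..s}"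
    using has_integral_mult_right[OF has_integral_powr_from_0[of "r / q - r / p - 1" s]] e assms by simp
  moreover have eq: "integrand t = c powr r * t powr (r / q - r / p - 1)" if "t \<in> {0..s}" for t
  proof (cases "t = 0")
    case False
    then have t: "0 < t" "t \<le> s" using that by auto
    have "s powr (- 1 / p) \<le> t powr (- 1 / p)" using t p_gt_1 by (intro powr_mono2') auto
    then have "L \<le> c * t powr (- 1 / p)" using assms(3) c_pos by (meson less_imp_le mult_left_mono order_trans)
    then have "profile p F f L t = c * t powr (- 1 / p)"
      using hyperbola_ge[of t] t assms by (simp add: profile_eq min_def max_def)
    then show ?thesis
      using c_pos t by (simp add: integrand_def powr_mult powr_powr mult.left_commute flip: powr_add) (simp add: algebra_simps)
  qed (simp add: integrand_def)
  ultimately show ?thesis using has_integral_eq[OF eq[symmetric] int] by simp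
qed

lemma has_integral_flat:
  assumes "0 < s" "s \<le> 1" "\<And>t. s \<le> t \<Longrightarrow> min (f / t) (c * t powr (- 1 / p)) \<le> L"
  shows "(integrand has_integral L powr r * ((1 - s powr (r / q)) / (r / q))) {s..1}"
proof -
  have int: "((\<lambda>t. L powr r * t powr (r / q - 1)) has_integral L powr r * ((1 powr (r / q) - s powr (r / q)) / (r / q))) {s..1}"
    using assms r q by (intro has_integral_mult_right has_integral_powr_Icc) auto
  moreover have eq: "integrand t = L powr r * t powr (r / q - 1)" if "t \<in> {s..1}" for t
    using assms(3)[of t] that by (simp add: integrand_def profile_eq max_absorb1)
  ultimately show ?thesis using has_integral_eq[OF eq[symmetric] int] by simp
qed

text \<open>Between \<open>t0\<close> and f / L the hyperbola is the smaller branch and still above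
  \<open>L\<close>. The exponent \<open>r / q - r\<close> is negative, hence the reversed
  signs.\<close>

lemma has_integral_middle:
  assumes "t0 \<le> s" "s \<le> f / L"
  shows "(integrand has_integral f powr r * ((t0 powr (r / q - r) - s powr (r / q - r)) / (r - r / q))) {t0..s}"
proof -
  have e: "r / q - r < 0" using q r by (simp add: field_simps)
  have int: "((\<lambda>t. f powr r * t powr (r / q - r - 1)) has_integral f powr r * ((s powr (r / q - r) - t0 powr (r / q - r)) / (r / q - r))) {t0..s}"
    using assms e t0_bounds by (intro has_integral_mult_right has_integral_powr_Icc) auto
  moreover have "(s powr (r / q - r) - t0 powr (r / q - r)) / (r / q - r) = (t0 powr (r / q - r) - s powr (r / q - r)) / (r - r / q)"
    by (metis minus_diff_eq minus_divide_divide)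
  moreover have eq: "integrand t = f powr r * t powr (r / q - r - 1)" if "t \<in> {t0..s}" for t
  proof -
    have t: "0 < t" "t0 \<le> t" "t \<le> f / L" using that t0_bounds assms by auto
    then have "L \<le> f / t" using L_pos by (simp add: field_simps)
    then have "profile p F f L t = f / t"
      using hyperbola_le[OF t(2)] by (simp add: profile_eq)
    then show ?thesis
      using f t by (simp add: integrand_def powr_divide powr_diff mult.commute)
  qed
  ultimately show ?thesis using has_integral_eq[OF eq[symmetric] int] by simp
qed

text \<open>Here \<open>L\<close> cuts the hyperbola, giving three pieces: power branch, hyperbola
  and constant. \<open>X\<close> and \<open>Y\<close> are the boundary terms at the two
  junctions.\<close>

lemma integral_small_level:
  assumes "L \<le> f / t0"
  defines "X \<equiv> (p / (p - 1)) powr (p / (p - 1) * r / (q / (q - 1))) * f powr (r * (p - q) / (q * (p - 1))) * F powr (r * (q - 1) / (q * (p - 1)))"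
    and "Y \<equiv> f powr (r / q) * L powr (r / q * (q - 1))"
  shows "(integrand has_integral q * (p - 1) * (q / (q - 1)) / (r * (p - q)) * X + q / r * L powr r - q / r * (q / (q - 1)) * Y) {0..1}"
proof -
  \<comment> \<open>The point where the hyperbola falls to \<open>L\<close>; it is at most 1 because
    \<open>f \<le> L\<close>.\<close>
  define t1 where "t1 = f / L"
  have t1: "0 < t1" "t1 \<le> 1" "t0 \<le> t1" using f L_pos fL assms t0_bounds by (auto simp: t1_def field_simps)
  have Xpos: "0 < X" using p_gt_1 F f by (simp add: X_def)
  have lnX: "ln X = p / (p - 1) * r / (q / (q - 1)) * ln (p / (p - 1)) + r * (p - q) / (q * (p - 1)) * ln f + r * (q - 1) / (q * (p - 1)) * ln F"
    using p_gt_1 F f by (simp add: X_def ln_mult ln_powr)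
  have X1: "f powr r * t0 powr (r / q - r) = X"
  proof (rule powr_eqI)
    have "ln (f powr r * t0 powr (r / q - r)) = r * ln f + (r / q - r) * (p / (p - 1) * (ln f - (ln (p / (p - 1)) + 1 / p * ln F)))"
      using f t0_bounds by (subst ln_mult) (simp_all only: ln_powr ln_t0 ln_c powr_gt_zero, auto)
    also have "\<dots> = ln X" unfolding lnX using p_gt_1 q by (simp add: divide_simps) (simp add: algebra_simps)
    finally show "ln (f powr r * t0 powr (r / q - r)) = ln X" .
  qed (use f t0_bounds Xpos in auto)
  \<comment> \<open>The branches agree at \<open>t0\<close>, so the pieces on both sides share the
    boundary term \<open>X\<close>.\<close>
  have X2: "c powr r * t0 powr (r / q - r / p) = X"
  proof -
    have "(f / t0) powr r = (c * t0 powr (- 1 / p)) powr r" by (simp only: t0_eq)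
    then have "f powr r * t0 powr (- r) = c powr r * t0 powr (- r / p)"
      using f t0_bounds c_pos by (simp add: powr_divide powr_mult powr_powr powr_minus_divide)
    then have "f powr r * t0 powr (- r) * t0 powr (r / q) = c powr r * t0 powr (- r / p) * t0 powr (r / q)" by simp
    then show ?thesis unfolding X1[symmetric] by (simp add: mult.assoc flip: powr_add)
  qed
  have Y1: "f powr r * t1 powr (r / q - r) = Y"
    using f L_pos q by (simp add: t1_def Y_def powr_divide powr_diff powr_minus_divide field_simps flip: powr_add)
  have Y2: "L powr r * t1 powr (r / q) = Y"
    using f L_pos q by (simp add: t1_def Y_def powr_divide powr_diff powr_minus_divide field_simps flip: powr_add)
  have 1: "(integrand has_integral X / (r / q - r / p)) {0..t0}"
    using has_integral_small[of t0] t0_bounds assms(1) by (simp add: t0_eq X2)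
  have 2: "(integrand has_integral (X - Y) / (r - r / q)) {t0..t1}"
    using has_integral_middle[of t1] t1 by (simp add: t1_def[symmetric] right_diff_distrib X1 Y1)
  have flat: "min (f / t) (c * t powr (- 1 / p)) \<le> L" if "t1 \<le> t" for t
  proof -
    have "0 < t" using that t1 by simp
    then have "f / t \<le> L" using that L_pos by (simp add: t1_def field_simps)
    then show ?thesis by simp
  qed
  have 3: "(integrand has_integral (L powr r - Y) / (r / q)) {t1..1}"
    using has_integral_flat[OF t1(1,2) flat] by (simp only: times_divide_eq_right right_diff_distrib mult_1_right Y2)
  have "(integrand has_integral X / (r / q - r / p) + (X - Y) / (r - r / q) + (L powr r - Y) / (r / q)) {0..1}"
    using t0_bounds t1 by (intro has_integral_combine[OF _ _ has_integral_combine[OF _ _ 1 2] 3]) auto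
  moreover have "X / (r / q - r / p) + (X - Y) / (r - r / q) + (L powr r - Y) / (r / q) =
      q * (p - 1) * (q / (q - 1)) / (r * (p - q)) * X + q / r * L powr r - q / r * (q / (q - 1)) * Y"
  proof -
    have e: "r / q - r / p = r * (p - q) / (q * p)" "r - r / q = r * (q - 1) / q" using p_gt_1 q by (auto simp: field_simps)
    have n: "p - q \<noteq> 0" "q - 1 \<noteq> 0" "p \<noteq> 0" "q \<noteq> 0" "r \<noteq> 0" using p_gt_1 q qp r by auto
    show ?thesis unfolding e using n by (simp add: divide_simps) (simp add: algebra_simps)
  qed
  ultimately show ?thesis by simp
qed

text \<open>Here \<open>L\<close> cuts the power branch before the hyperbola takes over, leaving two
  pieces with the single boundary term \<open>Z\<close>.\<close>

lemma integral_large_level: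
  assumes "f / t0 \<le> L"
  defines "Z \<equiv> (p / (p - 1)) powr (r * p / q) * F powr (r / q) * L powr (r * (1 - p / q))"
  shows "(integrand has_integral q / (r * (p / q - 1)) * Z + q / r * L powr r) {0..1}"
proof -
  \<comment> \<open>The solution of c t^(-1/p) = L.\<close>
  define t1 where "t1 = (c / L) powr p"
  have t1: "0 < t1" using c_pos L_pos by (simp add: t1_def)
  have L_eq: "c * t1 powr (- 1 / p) = L" using c_pos L_pos p_gt_1 by (simp add: t1_def powr_powr powr_minus_divide)
  have "c * t0 powr (- 1 / p) \<le> c * t1 powr (- 1 / p)" using assms(1) unfolding L_eq t0_eq .
  then have "t0 powr (- 1 / p) \<le> t1 powr (- 1 / p)" using c_pos by simp
  then have "t1 \<le> t0" using powr_less_mono2_neg[of "- 1 / p" t0 t1] t0_bounds p_gt_1 by (force simp: not_less[symmetric])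
  then have "t1 \<le> 1" using t0_bounds by simp
  have cp: "c powr (r * p / q) = (p / (p - 1)) powr (r * p / q) * F powr (r / q)"
    unfolding c_def using p_gt_1 F by (subst powr_mult) (auto simp: powr_powr)
  have Z2: "L powr r * t1 powr (r / q) = Z"
  proof -
    have "t1 powr (r / q) = (c / L) powr (r * p / q)" by (simp add: t1_def powr_powr mult.commute)
    also have "\<dots> = c powr (r * p / q) / L powr (r * p / q)" using c_pos L_pos by (simp add: powr_divide)
    finally show ?thesis using L_pos unfolding cp by (simp add: Z_def right_diff_distrib powr_diff)
  qed
  have Z1: "c powr r * t1 powr (r / q - r / p) = Z"
  proof -
    have "L powr r = c powr r * t1 powr (- r / p)"
      using c_pos t1 by (simp add: L_eq[symmetric] powr_mult powr_powr)
    then show ?thesis unfolding Z2[symmetric] by (simp add: mult.assoc flip: powr_add)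
  qed
  have 1: "(integrand has_integral Z / (r / q - r / p)) {0..t1}"
    using has_integral_small[OF t1 \<open>t1 \<le> t0\<close>] by (simp only: L_eq Z1 order_refl simp_thms)
  have flat: "min (f / t) (c * t powr (- 1 / p)) \<le> L" if "t1 \<le> t" for t
  proof -
    have "c * t powr (- 1 / p) \<le> c * t1 powr (- 1 / p)"
      using that t1 c_pos p_gt_1 by (intro mult_left_mono powr_mono2') auto
    then show ?thesis unfolding L_eq by simp
  qed
  have 2: "(integrand has_integral (L powr r - Z) / (r / q)) {t1..1}"
    using has_integral_flat[OF t1 \<open>t1 \<le> 1\<close> flat] by (simp only: times_divide_eq_right right_diff_distrib mult_1_right Z2)
  have "(integrand has_integral Z / (r / q - r / p) + (L powr r - Z) / (r / q)) {0..1}"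
    using t1 \<open>t1 \<le> 1\<close> by (intro has_integral_combine[OF _ _ 1 2]) auto
  moreover have "Z / (r / q - r / p) + (L powr r - Z) / (r / q) = q / (r * (p / q - 1)) * Z + q / r * L powr r"
  proof -
    have e: "r / q - r / p = r * (p - q) / (q * p)" "p / q - 1 = (p - q) / q" using p_gt_1 q by (auto simp: field_simps)
    have n: "p - q \<noteq> 0" "p \<noteq> 0" "q \<noteq> 0" "r \<noteq> 0" using p_gt_1 q qp r by auto
    show ?thesis unfolding e using n by (simp add: divide_simps) (simp add: algebra_simps)
  qed
  ultimately show ?thesis by simp
qed

end

theorem theorem3:
  fixes M :: "'a measure" and T :: "'a set set"
    and p q r p' q' F f L :: real
  assumes "prob_space M" and "nonatomic M" and "is_tree M T"
    and "1 < q" and "q < p" and "0 < r"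
    and "p' = p / (p - 1)" and "q' = q / (q - 1)"
    and "0 < F" and "0 < f" and "f < p' * F powr (1 / p)" and "f \<le> L"
  shows "(L \<le> p' powr p' * (F / f) powr (1 / (p - 1)) \<longrightarrow>
           enn2ereal (bellman M T p q r F f L) =
             ereal (q * (p - 1) * q' / (r * (p - q)) * p' powr (p' * r / q')
                      * f powr (r * (p - q) / (q * (p - 1)))
                      * F powr (r * (q - 1) / (q * (p - 1)))
                    + q / r * L powr r
                    - q / r * q' * f powr (r / q) * L powr (r / q * (q - 1)))) \<and>
         (p' powr p' * (F / f) powr (1 / (p - 1)) \<le> L \<longrightarrow>
           enn2ereal (bellman M T p q r F f L) =
             ereal (q * p' powr (r * p / q) / (r * (p / q - 1))
                      * F powr (r / q) * L powr (r * (1 - p / q))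
                    + q / r * L powr r))"
proof -
  interpret profile_params p q r F f L
    using assms by unfold_locales auto
  obtain C where "tree_space M T C" using is_tree_obtain assms(1,3) by blast
  then have B: "bellman M T p q r F f L =
      (\<integral>\<^sup>+t\<in>{0<..1}. ennreal (t powr (r / q - 1) * profile p F f L t powr r) \<partial>lborel)"
    by (rule tree_space.bellman_eq_profile_integral) (use p_gt_1 r F f L_pos less in auto)
  \<comment> \<open>Nonnegativity of \<open>v\<close> ensures that \<open>ennreal v\<close> is not
    cut off at 0 when read in the extended reals.\<close>
  have val: "enn2ereal (bellman M T p q r F f L) = ereal v" if "(integrand has_integral v) {0..1}" for v
    unfolding B nn_integral_eq(1)[OF that] using nn_integral_eq(2)[OF that] by simp
  show ?thesis
    unfolding assms(7,8) crossover
    using val[OF integral_small_level] val[OF integral_large_level] by (simp add: mult.assoc)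
qed

end
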